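(* Let $M$ be a closed oriented smooth $4$-manifold with Riemannian metric $g$. For every $\mathrm{spin}^{\mathbb{C}}$-structure on $M$, with spinor bundles $\mathcal{W}^\pm$ and determinant line bundle $L$, every unitary connection $A$ on $L$, and every $\phi\in\Gamma(\mathcal{W}^+)$, $$\|\phi\|^2\,\mathcal{D}^A\phi=i\bigl(2\,d^*\sigma(\phi)+\langle\nabla^A\phi,\,i\phi\rangle_{\mathbb{R}}\bigr)\bullet\phi .$$
   Context: $TM$ and $T^*M$ are identified via $g$; $\Lambda^+$ is the bundle of self-dual $2$-forms. A $\mathrm{spin}^{\mathbb{C}}$-structure has Hermitian complex rank-$2$ bundles $\mathcal{W}^+,\mathcal{W}^-$ of self-dual/anti-self-dual spinors, determinant line bundle $L=\det_{\mathbb{C}}\mathcal{W}^\pm$, and Clifford multiplication $TM\times\mathcal{W}^\pm\to\mathcal{W}^\mp$, $(v,\phi)\mapsto v\bullet\phi$, with $v\bullet v\bullet\phi=-|v|^2\phi$, extended complex-linearly to forms by letting $e_{i_1}\wedge\dots\wedge e_{i_k}$ act as $e_{i_1}\bullet\cdots\bullet e_{i_k}\bullet$ for orthonormal vectors; for an oriented orthonormal frame $e_1e_2e_3e_4$ acts on $\mathcal{W}^+$ as $-1$. Squaring map: $\sigma:\mathcal{W}^+\to\Lambda^+$ is defined by requiring that Clifford action of $i\sigma(\phi)$ on $\mathcal{W}^+$ be the traceless endomorphism $\phi\otimes\phi^*-\tfrac12\|\phi\|^2\,\mathrm{id}$; in particular $\sigma(\phi)\bullet\phi=-\tfrac{i}{2}\|\phi\|^2\phi$.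 Connections: the Levi-Civita connection $\nabla$ and a unitary connection $A$ on $L$ determine a unique connection $\nabla^A$ on $\mathcal{W}^\pm$ that is compatible with the Hermitian metrics, satisfies $\nabla^A(v\bullet\phi)=(\nabla v)\bullet\phi+v\bullet\nabla^A\phi$, and induces $A$ on $L$. The Dirac operator $\mathcal{D}^A:\Gamma(\mathcal{W}^+)\to\Gamma(\mathcal{W}^-)$ is $\mathcal{D}^A\phi=\sum_k e_k\bullet\nabla^A_{e_k}\phi$ for a local orthonormal frame $\{e_k\}$. $\langle\cdot,\cdot\rangle_{\mathbb{R}}$ is the real part of the Hermitian metric on $\mathcal{W}^+$, and $\langle\nabla^A\phi,i\phi\rangle_{\mathbb{R}}$ denotes the real $1$-form $X\mapsto\langle\nabla^A_X\phi,i\phi\rangle_{\mathbb{R}}$. $d^*=-*d*$ is the formal adjoint of $d$. *)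

theory Defs
  imports "HOL-Analysis.Analysis"
begin

section \<open>Smooth functions on open sets\<close>

text \<open>\<open>Ck_on k S f\<close> is meant for open \<open>S\<close>: all iterated directional derivatives of order at most \<open>k\<close>
  exist on \<open>S\<close> as Frechet derivatives and are continuous.\<close>

primrec Ck_on ::
  "nat \<Rightarrow> 'a::real_normed_vector set \<Rightarrow> ('a \<Rightarrow> 'b::real_normed_vector) \<Rightarrow> bool" where
  "Ck_on 0 S f \<longleftrightarrow> continuous_on S f"
| "Ck_on (Suc k) S f \<longleftrightarrow>
     f differentiable_on S \<and> (\<forall>v. Ck_on k S (\<lambda>x. frechet_derivative f (at x) v))"

definition smooth_on :: "'a::real_normed_vector set \<Rightarrow> ('a \<Rightarrow> 'b::real_normed_vector) \<Rightarrow> bool" where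
  "smooth_on S f \<longleftrightarrow> (\<forall>k. Ck_on k S f)"


section \<open>Oriented smooth 4-manifolds\<close>

text \<open>A manifold is the whole type \<open>'m\<close>.  Its smooth structure and its orientation are given by an
  oriented atlas, which need not be maximal.  A chart is a pair of its domain and its coordinate map
  (whose values outside of the domain are irrelevant).  The indices of \<^typ>\<open>real ^ 4\<close> are
  \<open>1, 2, 3, 4\<close>, in this order, where \<open>4 = 0\<close> in the index type.\<close>

type_synonym 'm chart = "'m set \<times> ('m \<Rightarrow> real ^ 4)"

definition coord_inv :: "'m chart \<Rightarrow> real ^ 4 \<Rightarrow> 'm" where
  "coord_inv a = inv_into (fst a) (snd a)"

definition transition :: "'m chart \<Rightarrow> 'm chart \<Rightarrow> real ^ 4 \<Rightarrow> real ^ 4" where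
  "transition a b = snd b \<circ> coord_inv a"

definition oriented_atlas :: "'m::topological_space chart set \<Rightarrow> bool" where
  "oriented_atlas \<A> \<longleftrightarrow>
     (\<Union>a\<in>\<A>. fst a) = UNIV \<and>
     (\<forall>a\<in>\<A>. open (fst a) \<and> open (snd a ` fst a) \<and>
        homeomorphism (fst a) (snd a ` fst a) (snd a) (coord_inv a)) \<and>
     (\<forall>a\<in>\<A>. \<forall>b\<in>\<A>. smooth_on (snd a ` (fst a \<inter> fst b)) (transition a b) \<and>
        (\<forall>x\<in>snd a ` (fst a \<inter> fst b). det (matrix (frechet_derivative (transition a b) (at x))) > 0))"

definition closed_oriented_4manifold ::
  "'m::{t2_space, second_countable_topology} chart set \<Rightarrow> bool" where
  "closed_oriented_4manifold \<A> \<longleftrightarrow> compact (UNIV :: 'm set) \<and> oriented_atlas \<A>"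

definition smooth_map ::
  "'m::topological_space chart set \<Rightarrow> 'm set \<Rightarrow> ('m \<Rightarrow> 'b::real_normed_vector) \<Rightarrow> bool" where
  "smooth_map \<A> V f \<longleftrightarrow> (\<forall>a\<in>\<A>. smooth_on (snd a ` (fst a \<inter> V)) (f \<circ> coord_inv a))"

definition chart_at :: "'m chart set \<Rightarrow> 'm \<Rightarrow> 'm chart" where
  "chart_at \<A> p = (SOME a. a \<in> \<A> \<and> p \<in> fst a)"


section \<open>Smooth vector bundles\<close>

text \<open>A bundle of \<open>'k\<close>-vector spaces of rank \<open>CARD('n)\<close>: total space, projection, fibrewise vector space
  operations and local trivialisations (an open set together with a map that is considered on the fibres
  over that set only).  The fibres are vector spaces because the trivialisations are bijective and
  intertwine the operations with those of \<open>'k ^ 'n\<close>; the topology and the smooth structure of the total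
  space are the ones determined by the trivialisations.\<close>

record ('m, 'e, 'k, 'n) vbundle =
  tot_space :: "'e set"
  bproj :: "'e \<Rightarrow> 'm"
  badd :: "'e \<Rightarrow> 'e \<Rightarrow> 'e"
  bscl :: "'k \<Rightarrow> 'e \<Rightarrow> 'e"
  trivs :: "('m set \<times> ('e \<Rightarrow> 'k ^ 'n)) set"

definition fibre :: "('m, 'e, 'k, 'n::finite) vbundle \<Rightarrow> 'm \<Rightarrow> 'e set" where
  "fibre E x = {e \<in> tot_space E. bproj E e = x}"

definition vector_bundle ::
  "'m::topological_space chart set \<Rightarrow> ('m, 'e, 'k::real_normed_field, 'n::finite) vbundle \<Rightarrow> bool" where
  "vector_bundle \<A> E \<longleftrightarrow>
     (\<forall>x. \<forall>e\<in>fibre E x. \<forall>e'\<in>fibre E x. badd E e e' \<in> fibre E x) \<and>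
     (\<forall>x. \<forall>e\<in>fibre E x. \<forall>c. bscl E c e \<in> fibre E x) \<and>
     (\<Union>t\<in>trivs E. fst t) = UNIV \<and>
     (\<forall>t\<in>trivs E. open (fst t) \<and>
        (\<forall>x\<in>fst t. bij_betw (snd t) (fibre E x) UNIV \<and>
           (\<forall>e\<in>fibre E x. \<forall>e'\<in>fibre E x. snd t (badd E e e') = snd t e + snd t e') \<and>
           (\<forall>e\<in>fibre E x. \<forall>c. snd t (bscl E c e) = c *s snd t e))) \<and>
     (\<forall>t\<in>trivs E. \<forall>t'\<in>trivs E. \<forall>y.
        smooth_map \<A> (fst t \<inter> fst t') (\<lambda>x. snd t' (inv_into (fibre E x) (snd t) y)))"

text \<open>The zero of a fibre is its only idempotent for addition.\<close>

definition zero_of :: "('m, 'e, 'k, 'n::finite) vbundle \<Rightarrow> 'm \<Rightarrow> 'e" where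
  "zero_of E x = (THE z. z \<in> fibre E x \<and> badd E z z = z)"

definition fibre_sum :: "('m, 'e, 'k, 'n::finite) vbundle \<Rightarrow> 'm \<Rightarrow> ('j \<Rightarrow> 'e) \<Rightarrow> 'j list \<Rightarrow> 'e" where
  "fibre_sum E x f ks = foldr (\<lambda>i e. badd E (f i) e) ks (zero_of E x)"

definition smooth_section ::
  "'m::topological_space chart set \<Rightarrow> ('m, 'e, 'k::real_normed_field, 'n::finite) vbundle \<Rightarrow>
   'm set \<Rightarrow> ('m \<Rightarrow> 'e) \<Rightarrow> bool" where
  "smooth_section \<A> E V s \<longleftrightarrow>
     (\<forall>x\<in>V. s x \<in> fibre E x) \<and> (\<forall>t\<in>trivs E. smooth_map \<A> (fst t \<inter> V) (snd t \<circ> s))"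


section \<open>The tangent bundle\<close>

text \<open>A tangent vector at \<open>p\<close> is \<open>(p, v)\<close>, where \<open>v\<close> assigns to every chart around \<open>p\<close> the components of
  the vector in that chart; they transform by the derivatives of the coordinate changes.  By convention
  \<open>v\<close> is zero on everything that is not a chart around \<open>p\<close>.\<close>

type_synonym 'm tangent = "'m \<times> ('m chart \<Rightarrow> real ^ 4)"

definition tangent_bundle :: "'m chart set \<Rightarrow> ('m, 'm tangent, real, 4) vbundle" where
  "tangent_bundle \<A> =
     \<lparr> tot_space = {(p, v). (\<forall>a. \<not> (a \<in> \<A> \<and> p \<in> fst a) \<longrightarrow> v a = 0) \<and>
                 (\<forall>a\<in>\<A>. \<forall>b\<in>\<A>. p \<in> fst a \<and> p \<in> fst b \<longrightarrow>
                    v b = frechet_derivative (transition a b) (at (snd a p)) (v a))},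
       bproj = fst,
       badd = (\<lambda>v w. (fst v, \<lambda>a. snd v a + snd w a)),
       bscl = (\<lambda>c v. (fst v, \<lambda>a. c *\<^sub>R snd v a)),
       trivs = (\<lambda>a. (fst a, \<lambda>v. snd v a)) ` \<A> \<rparr>"

abbreviation tangent_space :: "'m chart set \<Rightarrow> 'm \<Rightarrow> 'm tangent set" where
  "tangent_space \<A> p \<equiv> fibre (tangent_bundle \<A>) p"

text \<open>The derivative of a function in the direction of a tangent vector; it does not depend on the choice
  of the chart.\<close>

definition deriv_along ::
  "'m chart set \<Rightarrow> 'm tangent \<Rightarrow> ('m \<Rightarrow> 'b::real_normed_vector) \<Rightarrow> 'b" where
  "deriv_along \<A> v f =
     (let a = chart_at \<A> (fst v)
      in frechet_derivative (f \<circ> coord_inv a) (at (snd a (fst v))) (snd v a))"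

text \<open>The vector field on the domain of the chart \<open>a\<close> whose components in \<open>a\<close> are constant and equal to
  those of \<open>v\<close>.\<close>

definition const_field :: "'m chart set \<Rightarrow> 'm chart \<Rightarrow> 'm tangent \<Rightarrow> 'm \<Rightarrow> 'm tangent" where
  "const_field \<A> a v q =
     (q, \<lambda>b. if b \<in> \<A> \<and> q \<in> fst b
             then frechet_derivative (transition a b) (at (snd a q)) (snd v a) else 0)"

definition riemannian_metric ::
  "'m::topological_space chart set \<Rightarrow> ('m tangent \<Rightarrow> 'm tangent \<Rightarrow> real) \<Rightarrow> bool" where
  "riemannian_metric \<A> g \<longleftrightarrow>
     (let T = tangent_bundle \<A> in
      (\<forall>p. \<forall>u\<in>fibre T p. \<forall>v\<in>fibre T p. \<forall>w\<in>fibre T p. \<forall>c.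
         g (badd T u v) w = g u w + g v w \<and> g (bscl T c v) w = c * g v w \<and> g v w = g w v) \<and>
      (\<forall>p. \<forall>v\<in>fibre T p. v \<noteq> zero_of T p \<longrightarrow> g v v > 0) \<and>
      (\<forall>V X Y. open V \<and> smooth_section \<A> T V X \<and> smooth_section \<A> T V Y \<longrightarrow>
         smooth_map \<A> V (\<lambda>x. g (X x) (Y x))))"

text \<open>An orthonormal basis \<open>e 1, e 2, e 3, e 4\<close> of the tangent space at \<open>p\<close>, positively oriented.\<close>

definition oriented_frame ::
  "'m chart set \<Rightarrow> ('m tangent \<Rightarrow> 'm tangent \<Rightarrow> real) \<Rightarrow> 'm \<Rightarrow> (4 \<Rightarrow> 'm tangent) \<Rightarrow> bool" where
  "oriented_frame \<A> g p e \<longleftrightarrow>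
     (\<forall>i. e i \<in> tangent_space \<A> p) \<and>
     (\<forall>i j. g (e i) (e j) = (if i = j then 1 else 0)) \<and>
     (\<forall>a\<in>\<A>. p \<in> fst a \<longrightarrow> det (\<chi> i j. snd (e j) a $ i) > 0)"

text \<open>The operators below that use this choice do not depend on it.\<close>

definition frame_at ::
  "'m chart set \<Rightarrow> ('m tangent \<Rightarrow> 'm tangent \<Rightarrow> real) \<Rightarrow> 'm \<Rightarrow> 4 \<Rightarrow> 'm tangent" where
  "frame_at \<A> g p = (SOME e. oriented_frame \<A> g p e)"


section \<open>Differential forms\<close>

text \<open>A \<open>k\<close>-covector at \<open>p\<close> is a function of lists of tangent vectors, zero by convention on everything
  that is not a list of \<open>k\<close> tangent vectors at \<open>p\<close>.  A differential form assigns a covector to every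
  point.\<close>

type_synonym 'm covector = "'m tangent list \<Rightarrow> real"
type_synonym 'm dform = "'m \<Rightarrow> 'm covector"

definition vectors_at :: "'m chart set \<Rightarrow> nat \<Rightarrow> 'm \<Rightarrow> 'm tangent list set" where
  "vectors_at \<A> k p = {vs. length vs = k \<and> set vs \<subseteq> tangent_space \<A> p}"

definition alternating_at :: "'m chart set \<Rightarrow> nat \<Rightarrow> 'm \<Rightarrow> 'm covector set" where
  "alternating_at \<A> k p =
     {\<alpha>. (\<forall>vs. vs \<notin> vectors_at \<A> k p \<longrightarrow> \<alpha> vs = 0) \<and>
         (\<forall>vs\<in>vectors_at \<A> k p. \<forall>i<k. \<forall>v\<in>tangent_space \<A> p. \<forall>w\<in>tangent_space \<A> p. \<forall>c.
            \<alpha> (vs[i := badd (tangent_bundle \<A>) v w]) = \<alpha> (vs[i := v]) + \<alpha> (vs[i := w]) \<and>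
            \<alpha> (vs[i := bscl (tangent_bundle \<A>) c v]) = c * \<alpha> (vs[i := v])) \<and>
         (\<forall>vs\<in>vectors_at \<A> k p. \<forall>i<k. \<forall>j<k. i \<noteq> j \<and> vs ! i = vs ! j \<longrightarrow> \<alpha> vs = 0)}"

text \<open>The exterior derivative of a \<open>k\<close>-form.  Vector fields with constant components in a chart commute, so
  that only the terms without brackets of the invariant formula for \<open>d\<omega> (v\<^sub>0, \<dots>, v\<^sub>k)\<close> are left.\<close>

definition ext_deriv :: "'m chart set \<Rightarrow> nat \<Rightarrow> 'm dform \<Rightarrow> 'm dform" where
  "ext_deriv \<A> k \<omega> p vs =
     (if vs \<in> vectors_at \<A> (Suc k) p
      then \<Sum>j\<le>k. (-1) ^ j * deriv_along \<A> (vs ! j)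
             (\<lambda>q. \<omega> q (map (\<lambda>v. const_field \<A> (chart_at \<A> p) v q) (take j vs @ drop (Suc j) vs)))
      else 0)"

text \<open>The Hodge star of a \<open>k\<close>-covector at \<open>p\<close>, normalised by \<open>\<alpha> \<and> *\<beta> = \<langle>\<alpha>, \<beta>\<rangle> vol\<close>, that is,
  \<open>(*\<beta>)(v, \<dots>) = 1/k! \<Sum> \<beta>(e\<^sub>i, \<dots>) vol(e\<^sub>i, \<dots>, v, \<dots>)\<close>, summed over all \<open>k\<close>-tuples \<open>e\<^sub>i, \<dots>\<close> from the
  frame, with the volume form expanded as a determinant.\<close>

definition hodge_at ::
  "'m chart set \<Rightarrow> ('m tangent \<Rightarrow> 'm tangent \<Rightarrow> real) \<Rightarrow> nat \<Rightarrow> 'm \<Rightarrow> 'm covector \<Rightarrow> 'm covector" where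
  "hodge_at \<A> g k p \<beta> vs =
     (if vs \<in> vectors_at \<A> (4 - k) p
      then let e = frame_at \<A> g p in
        (\<Sum>\<pi> | \<pi> permutes (UNIV :: 4 set).
           of_int (sign \<pi>) * \<beta> (map (\<lambda>i. e (\<pi> i)) (take k [1, 2, 3, 4])) *
           prod_list (map2 (\<lambda>i v. g (e (\<pi> i)) v) (drop k [1, 2, 3, 4]) vs)) / fact k
      else 0)"

definition hodge ::
  "'m chart set \<Rightarrow> ('m tangent \<Rightarrow> 'm tangent \<Rightarrow> real) \<Rightarrow> nat \<Rightarrow> 'm dform \<Rightarrow> 'm dform" where
  "hodge \<A> g k \<omega> p = hodge_at \<A> g k p (\<omega> p)"

text \<open>\<open>d\<^sup>* = - * d *\<close> on \<open>k\<close>-forms, \<open>k \<ge> 1\<close>.\<close>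

definition codiff ::
  "'m chart set \<Rightarrow> ('m tangent \<Rightarrow> 'm tangent \<Rightarrow> real) \<Rightarrow> nat \<Rightarrow> 'm dform \<Rightarrow> 'm dform" where
  "codiff \<A> g k \<omega> p vs = - hodge \<A> g (5 - k) (ext_deriv \<A> (4 - k) (hodge \<A> g k \<omega>)) p vs"

definition self_dual_at ::
  "'m chart set \<Rightarrow> ('m tangent \<Rightarrow> 'm tangent \<Rightarrow> real) \<Rightarrow> 'm \<Rightarrow> 'm covector set" where
  "self_dual_at \<A> g p = {\<alpha> \<in> alternating_at \<A> 2 p. hodge_at \<A> g 2 p \<alpha> = \<alpha>}"


section \<open>Connections\<close>

text \<open>A connection as a covariant derivative \<open>N v s\<close> of sections \<open>s\<close> that are defined and smooth on some
  open neighbourhood \<open>V\<close> of the base point of \<open>v\<close>; the last condition makes it independent of \<open>V\<close> and of the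
  values of \<open>s\<close> outside of \<open>V\<close>.\<close>

definition connection ::
  "'m::topological_space chart set \<Rightarrow> ('m, 'e, 'k::real_normed_field, 'n::finite) vbundle \<Rightarrow>
   ('m tangent \<Rightarrow> ('m \<Rightarrow> 'e) \<Rightarrow> 'e) \<Rightarrow> bool" where
  "connection \<A> E N \<longleftrightarrow>
     (let T = tangent_bundle \<A> in
      \<forall>V s. open V \<and> smooth_section \<A> E V s \<longrightarrow>
        (\<forall>p\<in>V. \<forall>v\<in>fibre T p. N v s \<in> fibre E p) \<and>
        (\<forall>p\<in>V. \<forall>v\<in>fibre T p. \<forall>w\<in>fibre T p. N (badd T v w) s = badd E (N v s) (N w s)) \<and>
        (\<forall>p\<in>V. \<forall>v\<in>fibre T p. \<forall>c. N (bscl T c v) s = bscl E (of_real c) (N v s)) \<and>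
        (\<forall>t. smooth_section \<A> E V t \<longrightarrow>
           (\<forall>p\<in>V. \<forall>v\<in>fibre T p. N v (\<lambda>x. badd E (s x) (t x)) = badd E (N v s) (N v t))) \<and>
        (\<forall>f. smooth_map \<A> V f \<longrightarrow>
           (\<forall>p\<in>V. \<forall>v\<in>fibre T p. N v (\<lambda>x. bscl E (f x) (s x)) =
              badd E (bscl E (deriv_along \<A> v f) (s p)) (bscl E (f p) (N v s)))) \<and>
        (\<forall>X. smooth_section \<A> T V X \<longrightarrow> smooth_section \<A> E V (\<lambda>x. N (X x) s)) \<and>
        (\<forall>t. (\<forall>x\<in>V. t x = s x) \<longrightarrow> (\<forall>p\<in>V. \<forall>v\<in>fibre T p. N v t = N v s)))"

text \<open>Compatibility with a Riemannian or Hermitian metric \<open>h\<close> on the bundle.\<close>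

definition metric_connection ::
  "'m::topological_space chart set \<Rightarrow> ('m, 'e, 'k::real_normed_field, 'n::finite) vbundle \<Rightarrow>
   ('e \<Rightarrow> 'e \<Rightarrow> 'k) \<Rightarrow> ('m tangent \<Rightarrow> ('m \<Rightarrow> 'e) \<Rightarrow> 'e) \<Rightarrow> bool" where
  "metric_connection \<A> E h N \<longleftrightarrow> connection \<A> E N \<and>
     (\<forall>V s t. open V \<and> smooth_section \<A> E V s \<and> smooth_section \<A> E V t \<longrightarrow>
        (\<forall>p\<in>V. \<forall>v\<in>tangent_space \<A> p.
           deriv_along \<A> v (\<lambda>x. h (s x) (t x)) = h (N v s) (t p) + h (s p) (N v t)))"

text \<open>Vanishing of the torsion, \<open>N\<^sub>X Y - N\<^sub>Y X = [X, Y]\<close>, is tested on functions: a tangent vector is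
  determined by the derivatives of functions in its direction.\<close>

definition levi_civita ::
  "'m::topological_space chart set \<Rightarrow> ('m tangent \<Rightarrow> 'm tangent \<Rightarrow> real) \<Rightarrow>
   ('m tangent \<Rightarrow> ('m \<Rightarrow> 'm tangent) \<Rightarrow> 'm tangent) \<Rightarrow> bool" where
  "levi_civita \<A> g N \<longleftrightarrow> metric_connection \<A> (tangent_bundle \<A>) g N \<and>
     (\<forall>V X Y f. open V \<and> smooth_section \<A> (tangent_bundle \<A>) V X \<and>
        smooth_section \<A> (tangent_bundle \<A>) V Y \<and> smooth_map \<A> V (f :: 'm \<Rightarrow> real) \<longrightarrow>
        (\<forall>p\<in>V. deriv_along \<A> (N (X p) Y) f - deriv_along \<A> (N (Y p) X) f =
           deriv_along \<A> (X p) (\<lambda>q. deriv_along \<A> (Y q) f) -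
           deriv_along \<A> (Y p) (\<lambda>q. deriv_along \<A> (X q) f)))"


section \<open>Spin-c structures\<close>

text \<open>Hermitian metrics are complex-linear in the first argument.\<close>

definition hermitian_bundle ::
  "'m::topological_space chart set \<Rightarrow> ('m, 'e, complex, 'n::finite) vbundle \<Rightarrow>
   ('e \<Rightarrow> 'e \<Rightarrow> complex) \<Rightarrow> bool" where
  "hermitian_bundle \<A> E h \<longleftrightarrow> vector_bundle \<A> E \<and>
     (\<forall>x. \<forall>a\<in>fibre E x. \<forall>b\<in>fibre E x. \<forall>c\<in>fibre E x. \<forall>z.
        h (badd E a b) c = h a c + h b c \<and> h (bscl E z a) b = z * h a b \<and> h a b = cnj (h b a)) \<and>
     (\<forall>x. \<forall>a\<in>fibre E x. a \<noteq> zero_of E x \<longrightarrow> Re (h a a) > 0) \<and>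
     (\<forall>V s t. open V \<and> smooth_section \<A> E V s \<and> smooth_section \<A> E V t \<longrightarrow>
        smooth_map \<A> V (\<lambda>x. h (s x) (t x)))"

definition clifford_map ::
  "'m::topological_space chart set \<Rightarrow> ('m, 'w, complex, 2) vbundle \<Rightarrow> ('m, 'u, complex, 2) vbundle \<Rightarrow>
   ('m tangent \<Rightarrow> 'w \<Rightarrow> 'u) \<Rightarrow> bool" where
  "clifford_map \<A> W U cl \<longleftrightarrow>
     (let T = tangent_bundle \<A> in
      (\<forall>x. \<forall>v\<in>fibre T x. \<forall>w\<in>fibre T x. \<forall>a\<in>fibre W x. \<forall>b\<in>fibre W x. \<forall>c z.
         cl v a \<in> fibre U x \<and>
         cl (badd T v w) a = badd U (cl v a) (cl w a) \<and>
         cl (bscl T c v) a = bscl U (of_real c) (cl v a) \<and>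
         cl v (badd W a b) = badd U (cl v a) (cl v b) \<and>
         cl v (bscl W z a) = bscl U z (cl v a)) \<and>
      (\<forall>V X s. open V \<and> smooth_section \<A> T V X \<and> smooth_section \<A> W V s \<longrightarrow>
         smooth_section \<A> U V (\<lambda>x. cl (X x) (s x))))"

text \<open>\<open>det_bundle \<A> W h L k \<mu>\<close>: the Hermitian line bundle \<open>(L, k)\<close> is the second exterior power of the
  rank-2 bundle \<open>(W, h)\<close>, with \<open>\<mu> a b\<close> in the role of the exterior product of \<open>a\<close> and \<open>b\<close>.  By the last
  condition \<open>\<mu>\<close> is not zero on any fibre, so it identifies the fibre of \<open>L\<close> with the exterior square,
  isometrically.\<close>

definition det_bundle ::
  "'m::topological_space chart set \<Rightarrow> ('m, 'w, complex, 2) vbundle \<Rightarrow> ('w \<Rightarrow> 'w \<Rightarrow> complex) \<Rightarrow>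
   ('m, 'l, complex, 1) vbundle \<Rightarrow> ('l \<Rightarrow> 'l \<Rightarrow> complex) \<Rightarrow> ('w \<Rightarrow> 'w \<Rightarrow> 'l) \<Rightarrow> bool" where
  "det_bundle \<A> W h L k \<mu> \<longleftrightarrow>
     hermitian_bundle \<A> L k \<and>
     (\<forall>x. \<forall>a\<in>fibre W x. \<forall>b\<in>fibre W x. \<forall>c\<in>fibre W x. \<forall>z.
        \<mu> a b \<in> fibre L x \<and>
        \<mu> (badd W a b) c = badd L (\<mu> a c) (\<mu> b c) \<and> \<mu> (bscl W z a) b = bscl L z (\<mu> a b) \<and>
        \<mu> a (badd W b c) = badd L (\<mu> a b) (\<mu> a c) \<and> \<mu> a (bscl W z b) = bscl L z (\<mu> a b) \<and>
        \<mu> a a = zero_of L x) \<and>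
     (\<forall>V s t. open V \<and> smooth_section \<A> W V s \<and> smooth_section \<A> W V t \<longrightarrow>
        smooth_section \<A> L V (\<lambda>x. \<mu> (s x) (t x))) \<and>
     (\<forall>x. \<forall>a\<in>fibre W x. \<forall>b\<in>fibre W x. \<forall>c\<in>fibre W x. \<forall>d\<in>fibre W x.
        k (\<mu> a b) (\<mu> c d) = h a c * h b d - h a d * h b c)"

text \<open>The data of a spin-c structure: the spinor bundles \<open>Wp\<close>, \<open>Wm\<close> with metrics \<open>hp\<close>, \<open>hm\<close>; Clifford
  multiplication \<open>clp\<close>, \<open>clm\<close> on them; the determinant line bundle \<open>detL\<close> with metric \<open>hL\<close>; the exterior
  products \<open>wp\<close>, \<open>wm\<close> of two spinors.\<close>

record ('m, 'p, 'q, 'l) spinc =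
  Wp :: "('m, 'p, complex, 2) vbundle"
  hp :: "'p \<Rightarrow> 'p \<Rightarrow> complex"
  Wm :: "('m, 'q, complex, 2) vbundle"
  hm :: "'q \<Rightarrow> 'q \<Rightarrow> complex"
  clp :: "'m tangent \<Rightarrow> 'p \<Rightarrow> 'q"
  clm :: "'m tangent \<Rightarrow> 'q \<Rightarrow> 'p"
  detL :: "('m, 'l, complex, 1) vbundle"
  hL :: "'l \<Rightarrow> 'l \<Rightarrow> complex"
  wp :: "'p \<Rightarrow> 'p \<Rightarrow> 'l"
  wm :: "'q \<Rightarrow> 'q \<Rightarrow> 'l"

text \<open>Clifford multiplication by vectors is skew-Hermitian (equivalently, by unit vectors it is unitary).
  The condition on \<open>wm\<close> fixes the canonical identification of the determinants of \<open>Wp\<close> and \<open>Wm\<close>,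
  which are both \<open>detL\<close>.\<close>

definition spinc_structure ::
  "'m::topological_space chart set \<Rightarrow> ('m tangent \<Rightarrow> 'm tangent \<Rightarrow> real) \<Rightarrow>
   ('m, 'p, 'q, 'l) spinc \<Rightarrow> bool" where
  "spinc_structure \<A> g S \<longleftrightarrow>
     hermitian_bundle \<A> (Wp S) (hp S) \<and> hermitian_bundle \<A> (Wm S) (hm S) \<and>
     clifford_map \<A> (Wp S) (Wm S) (clp S) \<and> clifford_map \<A> (Wm S) (Wp S) (clm S) \<and>
     (\<forall>x. \<forall>v\<in>tangent_space \<A> x. \<forall>\<phi>\<in>fibre (Wp S) x.
        clm S v (clp S v \<phi>) = bscl (Wp S) (- of_real (g v v)) \<phi>) \<and>
     (\<forall>x. \<forall>v\<in>tangent_space \<A> x. \<forall>\<eta>\<in>fibre (Wm S) x.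
        clp S v (clm S v \<eta>) = bscl (Wm S) (- of_real (g v v)) \<eta>) \<and>
     (\<forall>x. \<forall>v\<in>tangent_space \<A> x. \<forall>\<phi>\<in>fibre (Wp S) x. \<forall>\<eta>\<in>fibre (Wm S) x.
        hm S (clp S v \<phi>) \<eta> = - hp S \<phi> (clm S v \<eta>)) \<and>
     (\<forall>x e. oriented_frame \<A> g x e \<longrightarrow> (\<forall>\<phi>\<in>fibre (Wp S) x.
        clm S (e 1) (clp S (e 2) (clm S (e 3) (clp S (e 4) \<phi>))) = bscl (Wp S) (-1) \<phi>)) \<and>
     det_bundle \<A> (Wp S) (hp S) (detL S) (hL S) (wp S) \<and>
     det_bundle \<A> (Wm S) (hm S) (detL S) (hL S) (wm S) \<and>
     (\<forall>x. \<forall>v\<in>tangent_space \<A> x. \<forall>\<phi>\<in>fibre (Wp S) x. \<forall>\<psi>\<in>fibre (Wp S) x.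
        wm S (clp S v \<phi>) (clp S v \<psi>) = bscl (detL S) (of_real (g v v)) (wp S \<phi> \<psi>))"

text \<open>Clifford action on self-dual spinors of 1-forms and of 2-forms: \<open>e\<^sub>i\<close>, identified with a 1-form by the
  metric, acts by \<open>e\<^sub>i\<close>, and \<open>e\<^sub>i \<and> e\<^sub>j\<close> acts by \<open>e\<^sub>i\<close> after \<open>e\<^sub>j\<close>.\<close>

definition cl1 ::
  "'m chart set \<Rightarrow> ('m tangent \<Rightarrow> 'm tangent \<Rightarrow> real) \<Rightarrow> ('m, 'p, 'q, 'l) spinc \<Rightarrow>
   'm covector \<Rightarrow> 'p \<Rightarrow> 'q" where
  "cl1 \<A> g S \<alpha> \<phi> =
     (let x = bproj (Wp S) \<phi>; e = frame_at \<A> g x in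
      fibre_sum (Wm S) x (\<lambda>i. bscl (Wm S) (of_real (\<alpha> [e i])) (clp S (e i) \<phi>)) [1, 2, 3, 4])"

definition cl2 ::
  "'m chart set \<Rightarrow> ('m tangent \<Rightarrow> 'm tangent \<Rightarrow> real) \<Rightarrow> ('m, 'p, 'q, 'l) spinc \<Rightarrow>
   'm covector \<Rightarrow> 'p \<Rightarrow> 'p" where
  "cl2 \<A> g S \<alpha> \<phi> =
     (let x = bproj (Wp S) \<phi>; e = frame_at \<A> g x in
      fibre_sum (Wp S) x
        (\<lambda>(i, j). bscl (Wp S) (of_real (\<alpha> [e i, e j])) (clm S (e i) (clp S (e j) \<phi>)))
        [(1, 2), (1, 3), (1, 4), (2, 3), (2, 4), (3, 4)])"

text \<open>The squaring map: \<open>i \<sigma>(\<phi>)\<close> acts as the endomorphism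
  \<open>\<psi> \<mapsto> \<langle>\<psi>, \<phi>\<rangle> \<phi> - 1/2 |\<phi>|\<^sup>2 \<psi>\<close>.\<close>

definition squaring ::
  "'m chart set \<Rightarrow> ('m tangent \<Rightarrow> 'm tangent \<Rightarrow> real) \<Rightarrow> ('m, 'p, 'q, 'l) spinc \<Rightarrow>
   'p \<Rightarrow> 'm covector" where
  "squaring \<A> g S \<phi> =
     (THE \<alpha>. \<alpha> \<in> self_dual_at \<A> g (bproj (Wp S) \<phi>) \<and>
        (\<forall>\<psi>\<in>fibre (Wp S) (bproj (Wp S) \<phi>).
           bscl (Wp S) \<i> (cl2 \<A> g S \<alpha> \<psi>) =
           badd (Wp S) (bscl (Wp S) (hp S \<psi> \<phi>) \<phi>) (bscl (Wp S) (- (hp S \<phi> \<phi> / 2)) \<psi>)))"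

text \<open>\<open>(Np, Nm)\<close> is the connection on the spinor bundles determined by the Levi-Civita connection \<open>N\<close> and by
  the unitary connection \<open>A\<close> on the determinant line bundle.\<close>

definition spinc_connection ::
  "'m::topological_space chart set \<Rightarrow> ('m tangent \<Rightarrow> 'm tangent \<Rightarrow> real) \<Rightarrow>
   ('m, 'p, 'q, 'l) spinc \<Rightarrow>
   ('m tangent \<Rightarrow> ('m \<Rightarrow> 'm tangent) \<Rightarrow> 'm tangent) \<Rightarrow>
   ('m tangent \<Rightarrow> ('m \<Rightarrow> 'l) \<Rightarrow> 'l) \<Rightarrow>
   ('m tangent \<Rightarrow> ('m \<Rightarrow> 'p) \<Rightarrow> 'p) \<Rightarrow> ('m tangent \<Rightarrow> ('m \<Rightarrow> 'q) \<Rightarrow> 'q) \<Rightarrow> bool" where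
  "spinc_connection \<A> g S N A Np Nm \<longleftrightarrow>
     metric_connection \<A> (Wp S) (hp S) Np \<and> metric_connection \<A> (Wm S) (hm S) Nm \<and>
     (\<forall>V X s. open V \<and> smooth_section \<A> (tangent_bundle \<A>) V X \<and> smooth_section \<A> (Wp S) V s \<longrightarrow>
        (\<forall>p\<in>V. \<forall>v\<in>tangent_space \<A> p. Nm v (\<lambda>x. clp S (X x) (s x)) =
           badd (Wm S) (clp S (N v X) (s p)) (clp S (X p) (Np v s)))) \<and>
     (\<forall>V X s. open V \<and> smooth_section \<A> (tangent_bundle \<A>) V X \<and> smooth_section \<A> (Wm S) V s \<longrightarrow>
        (\<forall>p\<in>V. \<forall>v\<in>tangent_space \<A> p. Np v (\<lambda>x. clm S (X x) (s x)) =
           badd (Wp S) (clm S (N v X) (s p)) (clm S (X p) (Nm v s)))) \<and>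
     (\<forall>V s t. open V \<and> smooth_section \<A> (Wp S) V s \<and> smooth_section \<A> (Wp S) V t \<longrightarrow>
        (\<forall>p\<in>V. \<forall>v\<in>tangent_space \<A> p. A v (\<lambda>x. wp S (s x) (t x)) =
           badd (detL S) (wp S (Np v s) (t p)) (wp S (s p) (Np v t)))) \<and>
     (\<forall>V s t. open V \<and> smooth_section \<A> (Wm S) V s \<and> smooth_section \<A> (Wm S) V t \<longrightarrow>
        (\<forall>p\<in>V. \<forall>v\<in>tangent_space \<A> p. A v (\<lambda>x. wm S (s x) (t x)) =
           badd (detL S) (wm S (Nm v s) (t p)) (wm S (s p) (Nm v t))))"

definition dirac ::
  "'m chart set \<Rightarrow> ('m tangent \<Rightarrow> 'm tangent \<Rightarrow> real) \<Rightarrow> ('m, 'p, 'q, 'l) spinc \<Rightarrow>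
   ('m tangent \<Rightarrow> ('m \<Rightarrow> 'p) \<Rightarrow> 'p) \<Rightarrow> ('m \<Rightarrow> 'p) \<Rightarrow> 'm \<Rightarrow> 'q" where
  "dirac \<A> g S Np \<phi> x =
     (let e = frame_at \<A> g x in
      fibre_sum (Wm S) x (\<lambda>k. clp S (e k) (Np (e k) \<phi>)) [1, 2, 3, 4])"

definition real_pairing ::
  "'m chart set \<Rightarrow> ('m, 'p, 'q, 'l) spinc \<Rightarrow>
   ('m tangent \<Rightarrow> ('m \<Rightarrow> 'p) \<Rightarrow> 'p) \<Rightarrow> ('m \<Rightarrow> 'p) \<Rightarrow> 'm dform" where
  "real_pairing \<A> S Np \<phi> x vs =
     (if vs \<in> vectors_at \<A> 1 x then Re (hp S (Np (hd vs) \<phi>) (bscl (Wp S) \<i> (\<phi> x))) else 0)"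

end

theory Submission
  imports Defs
begin

text \<open>
  Write \<open>\<nabla>\<close> for the spin-c connection and \<open>e\<^sub>1, \<dots>, e\<^sub>4\<close> for an oriented orthonormal frame at a point.  The Clifford
  product of \<open>e\<^sub>k\<close> and a 2-form \<open>\<omega>\<close> is \<open>e\<^sub>k \<and> \<omega>\<close> minus the contraction of \<open>\<omega>\<close> by \<open>e\<^sub>k\<close>, so that
  \<open>\<Sum>\<^sub>k e\<^sub>k \<bullet> \<nabla>\<^sub>k\<omega> = d\<omega> + d\<^sup>*\<omega>\<close>.  Because the volume element acts as \<open>-1\<close> on positive spinors, a 3-form \<open>\<beta>\<close>
  acts on them as the 1-form \<open>- *\<beta>\<close>; for a self-dual \<open>\<omega>\<close> this turns \<open>d\<omega>\<close> into \<open>- *d\<omega> = d\<^sup>*\<omega>\<close>, and the sum acts as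
  \<open>2 d\<^sup>*\<omega>\<close>.  Apply this to \<open>\<omega> = i\<sigma>(\<phi>)\<close>, which acts as \<open>\<phi> \<otimes> \<phi>\<^sup>* - 1/2 \<bar>\<phi>\<bar>\<^sup>2\<close>, differentiate this endomorphism by
  the Leibniz rule, and evaluate on \<open>\<phi>\<close>:

  \<open>2 i d\<^sup>*\<sigma>(\<phi>) \<bullet> \<phi> = \<Sum>\<^sub>k e\<^sub>k \<bullet> (\<bar>\<phi>\<bar>\<^sup>2 \<nabla>\<^sub>k\<phi> + \<langle>\<phi>, \<nabla>\<^sub>k\<phi>\<rangle> \<phi> - Re \<langle>\<nabla>\<^sub>k\<phi>, \<phi>\<rangle> \<phi>)\<close>.

  The first summand is \<open>\<bar>\<phi>\<bar>\<^sup>2\<close> times the Dirac operator.  The other two add up to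
  \<open>- i Im \<langle>\<nabla>\<^sub>k\<phi>, \<phi>\<rangle> \<phi>\<close>, and \<open>Im \<langle>\<nabla>\<^sub>k\<phi>, \<phi>\<rangle>\<close> is the real part of \<open>\<langle>\<nabla>\<^sub>k\<phi>, i\<phi>\<rangle>\<close>.

  The algebra takes place in \<open>clifford_frame\<close>, with positive and negative spinors in coordinates.  Since
  the products \<open>I = e\<^sub>1e\<^sub>2\<close>, \<open>J = e\<^sub>1e\<^sub>3\<close>, \<open>K = e\<^sub>1e\<^sub>4\<close> act as quaternions on a complex plane, they satisfy the identity
  \<open>fierz\<close>.  It shows that \<open>\<sigma>(\<phi>)(v, w) = - 1/4 Im \<langle>v \<bullet> w \<bullet> \<phi>, \<phi>\<rangle>\<close> (\<open>squaring_eq\<close>), and its polarised form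
  \<open>polarised_squaring\<close> yields \<open>pointwise_identity\<close>.

  The analysis computes \<open>d\<sigma>(\<phi>)\<close> from this formula (\<open>ext_deriv_sq\<close>).  For vector fields with constant components in a chart
  no brackets occur, the Leibniz rules give the covariant derivative of \<open>\<sigma>(\<phi>)\<close>, and the remaining terms
  cancel because the Levi-Civita connection has no torsion.  The required smoothness of these fields
  rests on the chain rule \<open>Ck_on_compose\<close>, and the values of the star on a frame are obtained from the 24
  permutations of four indices (\<open>hodge_2\<close>, \<open>hodge_3\<close>).
\<close>


section \<open>Iterated derivatives\<close>

text \<open>A derivative, or the arbitrary value that stands for a missing one, depends on the germ of the
  function only: the two functions have the same candidates for a derivative.\<close>

lemma frechet_derivative_cong_open:
  assumes "open S" "x \<in> S" "\<And>y. y \<in> S \<Longrightarrow> f y = g y"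
  shows "frechet_derivative f (at x) = frechet_derivative g (at x)"
proof -
  have "(f has_derivative f') (at x) \<longleftrightarrow> (g has_derivative f') (at x)" for f'
    using has_derivative_transform_within_open[OF _ assms(1,2), of f f' UNIV g]
      has_derivative_transform_within_open[OF _ assms(1,2), of g f' UNIV f] assms(3) by auto
  then show ?thesis by (simp add: frechet_derivative_def)
qed

lemma Ck_on_subset: "Ck_on k S f \<Longrightarrow> T \<subseteq> S \<Longrightarrow> Ck_on k T f"
  by (induction k arbitrary: f) (auto intro: continuous_on_subset differentiable_on_subset)

lemma Ck_on_SucD: "Ck_on (Suc k) S f \<Longrightarrow> Ck_on k S f"
  by (induction k arbitrary: f) (auto intro: differentiable_imp_continuous_on)

lemma Ck_on_cong:
  assumes "open S" "\<And>x. x \<in> S \<Longrightarrow> f x = g x" "Ck_on k S f"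
  shows "Ck_on k S g"
  using assms(2,3)
proof (induction k arbitrary: f g)
  case 0
  then show ?case by (metis Ck_on.simps(1) continuous_on_cong)
next
  case (Suc k)
  have "g differentiable_on S"
    unfolding differentiable_on_eq_differentiable_at[OF assms(1)]
  proof
    fix x assume x: "x \<in> S"
    with Suc.prems(2) obtain D where "(f has_derivative D) (at x)"
      by (auto simp: differentiable_on_eq_differentiable_at[OF assms(1)] differentiable_def)
    then have "(g has_derivative D) (at x)"
      by (rule has_derivative_transform_within_open[OF _ assms(1) x Suc.prems(1)])
    then show "g differentiable at x" by (auto simp: differentiable_def)
  qed
  moreover have "Ck_on k S (\<lambda>x. frechet_derivative g (at x) v)" for v
  proof (rule Suc.IH)
    show "Ck_on k S (\<lambda>x. frechet_derivative f (at x) v)" using Suc.prems(2) by simp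
    show "frechet_derivative f (at x) v = frechet_derivative g (at x) v" if "x \<in> S" for x
      using frechet_derivative_cong_open[OF assms(1) that Suc.prems(1)] by simp
  qed
  ultimately show ?case by simp
qed

lemma Ck_on_differentiable:
  assumes "open S" "Ck_on (Suc k) S f" "x \<in> S"
  shows "(f has_derivative frechet_derivative f (at x)) (at x)"
  using assms by (simp add: differentiable_on_eq_differentiable_at frechet_derivative_works)

text \<open>The introduction rule for the next order of differentiability: it is enough to know some derivative,
  in whatever form, and to check the regularity of that form.\<close>

lemma Ck_on_SucI:
  assumes "open S" "\<And>x. x \<in> S \<Longrightarrow> (f has_derivative D x) (at x)" "\<And>v. Ck_on k S (\<lambda>x. D x v)"
  shows "Ck_on (Suc k) S f"
proof -
  have "f differentiable_on S"
    using assms(2) by (auto simp: differentiable_on_eq_differentiable_at[OF assms(1)] differentiable_def)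
  moreover have "Ck_on k S (\<lambda>x. frechet_derivative f (at x) v)" for v
    by (rule Ck_on_cong[OF assms(1) _ assms(3)]) (simp add: frechet_derivative_at[OF assms(2), symmetric])
  ultimately show ?thesis by simp
qed

lemma Ck_on_const: "Ck_on k S (\<lambda>x. c)"
  by (induction k arbitrary: c) (simp_all add: frechet_derivative_const)

lemma Ck_on_linear:
  assumes "open S" "bounded_linear L" "Ck_on k S f"
  shows "Ck_on k S (\<lambda>x. L (f x))"
  using assms(3)
proof (induction k arbitrary: f)
  case 0
  then show ?case using bounded_linear.continuous_on[OF assms(2)] by simp
next
  case (Suc k)
  show ?case
  proof (rule Ck_on_SucI[OF assms(1)])
    show "((\<lambda>x. L (f x)) has_derivative (\<lambda>v. L (frechet_derivative f (at x) v))) (at x)" if "x \<in> S" for x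
      using bounded_linear.has_derivative[OF assms(2) Ck_on_differentiable[OF assms(1) Suc.prems that]] .
    show "Ck_on k S (\<lambda>x. L (frechet_derivative f (at x) v))" for v
      using Suc.prems by (intro Suc.IH) simp_all
  qed
qed

lemma Ck_on_add:
  assumes "open S" "Ck_on k S f" "Ck_on k S g"
  shows "Ck_on k S (\<lambda>x. f x + g x)"
  using assms(2,3)
proof (induction k arbitrary: f g)
  case 0
  then show ?case by (simp add: continuous_on_add)
next
  case (Suc k)
  show ?case
  proof (rule Ck_on_SucI[OF assms(1)])
    show "((\<lambda>x. f x + g x) has_derivative
        (\<lambda>v. frechet_derivative f (at x) v + frechet_derivative g (at x) v)) (at x)" if "x \<in> S" for x
      using Suc.prems that by (intro has_derivative_add Ck_on_differentiable[OF assms(1)])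
    show "Ck_on k S (\<lambda>x. frechet_derivative f (at x) v + frechet_derivative g (at x) v)" for v
      using Suc.prems by (intro Suc.IH) simp_all
  qed
qed

lemma Ck_on_sum:
  assumes "open S" "finite F" "\<And>i. Ck_on k S (f i)"
  shows "Ck_on k S (\<lambda>x. \<Sum>i\<in>F. f i x)"
  using assms(2)
proof (induction F rule: finite_induct)
  case (insert i F)
  have "Ck_on k S (\<lambda>x. f i x + (\<Sum>i\<in>F. f i x))"
    using assms(1,3) insert.IH by (rule Ck_on_add)
  then show ?case using insert.hyps by simp
qed (simp add: Ck_on_const)

lemma Ck_on_scaleR:
  assumes "open S" "Ck_on k S f" "Ck_on k S g"
  shows "Ck_on k S (\<lambda>x. f x *\<^sub>R g x)"
  using assms(2,3)
proof (induction k arbitrary: f g)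
  case 0
  then show ?case by (simp add: continuous_on_scaleR)
next
  case (Suc k)
  show ?case
  proof (rule Ck_on_SucI[OF assms(1)])
    show "((\<lambda>x. f x *\<^sub>R g x) has_derivative
        (\<lambda>v. f x *\<^sub>R frechet_derivative g (at x) v + frechet_derivative f (at x) v *\<^sub>R g x)) (at x)" if "x \<in> S" for x
      using Suc.prems that by (intro has_derivative_scaleR Ck_on_differentiable[OF assms(1)])
    show "Ck_on k S (\<lambda>x. f x *\<^sub>R frechet_derivative g (at x) v + frechet_derivative f (at x) v *\<^sub>R g x)" for v
      using Suc.prems Ck_on_SucD[OF Suc.prems(1)] Ck_on_SucD[OF Suc.prems(2)]
      by (intro Ck_on_add[OF assms(1)] Suc.IH) simp_all
  qed
qed

text \<open>The chain rule involves the derivative of \<open>f\<close> in the moving direction \<open>Dg(x) v\<close>, whereas only derivatives in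
  constant directions are known to be regular.  So the moving direction is expanded in the standard
  basis, and the product rule applies to each summand.\<close>

lemma Ck_on_compose:
  fixes g :: "'a::real_normed_vector \<Rightarrow> real ^ 'n"
  assumes "open S" "open T" "g ` S \<subseteq> T" "Ck_on k T f" "Ck_on k S g"
  shows "Ck_on k S (\<lambda>x. f (g x))"
  using assms(4,5)
proof (induction k arbitrary: f)
  case 0
  then show ?case using assms(3) by (auto intro: continuous_on_compose2)
next
  case (Suc k)
  let ?D = "\<lambda>x v. frechet_derivative f (at (g x)) (frechet_derivative g (at x) v)"
  let ?E = "\<lambda>x v. \<Sum>i\<in>UNIV. (frechet_derivative g (at x) v $ i) *\<^sub>R frechet_derivative f (at (g x)) (axis i 1)"
  have f: "(f has_derivative frechet_derivative f (at (g x))) (at (g x))" if "x \<in> S" for x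
    using Ck_on_differentiable[OF assms(2) Suc.prems(1)] assms(3) that by blast
  show ?case
  proof (rule Ck_on_SucI[OF assms(1)])
    show "((\<lambda>x. f (g x)) has_derivative ?D x) (at x)" if "x \<in> S" for x
      using has_derivative_compose[OF Ck_on_differentiable[OF assms(1) Suc.prems(2) that] f[OF that]] .
    show "Ck_on k S (\<lambda>x. ?D x v)" for v
    proof (rule Ck_on_cong[OF assms(1)])
      show "?E x v = ?D x v" if "x \<in> S" for x
      proof -
        let ?u = "frechet_derivative g (at x) v"
        have lin: "linear (frechet_derivative f (at (g x)))"
          using f[OF that] by (rule has_derivative_linear)
        have "?D x v = frechet_derivative f (at (g x)) (\<Sum>i\<in>UNIV. (?u $ i) *\<^sub>R axis i 1)"
          using basis_expansion[of ?u] by (simp add: scalar_mult_eq_scaleR)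
        also have "\<dots> = ?E x v" by (simp add: linear_sum[OF lin] linear_cmul[OF lin] o_def)
        finally show ?thesis by simp
      qed
      have summand: "Ck_on k S (\<lambda>x. (frechet_derivative g (at x) v $ i) *\<^sub>R frechet_derivative f (at (g x)) (axis i 1))" for i
      proof (rule Ck_on_scaleR[OF assms(1)])
        show "Ck_on k S (\<lambda>x. frechet_derivative g (at x) v $ i)"
          using Suc.prems(2) by (intro Ck_on_linear[OF assms(1) bounded_linear_vec_nth]) simp
        show "Ck_on k S (\<lambda>x. frechet_derivative f (at (g x)) (axis i 1))"
          using Suc.prems Ck_on_SucD[OF Suc.prems(2)] by (intro Suc.IH) simp_all
      qed
      show "Ck_on k S (\<lambda>x. ?E x v)" by (rule Ck_on_sum[OF assms(1) finite_class.finite_UNIV summand])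
    qed
  qed
qed


section \<open>Tangent vectors and charts\<close>

lemma smooth_map_subset: "smooth_map \<A> V f \<Longrightarrow> U \<subseteq> V \<Longrightarrow> smooth_map \<A> U f"
  unfolding smooth_map_def smooth_on_def
  by (meson Ck_on_subset Int_mono image_mono order_refl)

lemma smooth_section_subset: "smooth_section \<A> E V s \<Longrightarrow> U \<subseteq> V \<Longrightarrow> smooth_section \<A> E U s"
  unfolding smooth_section_def by (meson Int_mono order_refl smooth_map_subset subsetD)

locale oriented_manifold =
  fixes \<A> :: "'m::topological_space chart set"
  assumes atlas: "oriented_atlas \<A>"
begin

abbreviation "T \<equiv> tangent_bundle \<A>"
abbreviation "D a b q \<equiv> frechet_derivative (transition a b) (at (snd a q))"

lemma chart_homeo: "a \<in> \<A> \<Longrightarrow> homeomorphism (fst a) (snd a ` fst a) (snd a) (coord_inv a)"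
  and chart_open: "a \<in> \<A> \<Longrightarrow> open (fst a)"
  and chart_image_open: "a \<in> \<A> \<Longrightarrow> open (snd a ` fst a)"
  and transition_smooth: "a \<in> \<A> \<Longrightarrow> b \<in> \<A> \<Longrightarrow> smooth_on (snd a ` (fst a \<inter> fst b)) (transition a b)"
  and transition_det: "a \<in> \<A> \<Longrightarrow> b \<in> \<A> \<Longrightarrow> q \<in> fst a \<Longrightarrow> q \<in> fst b \<Longrightarrow> det (matrix (D a b q)) > 0"
  using atlas unfolding oriented_atlas_def by blast+

lemma coord_inv: "a \<in> \<A> \<Longrightarrow> p \<in> fst a \<Longrightarrow> coord_inv a (snd a p) = p"
  using chart_homeo by (auto simp: homeomorphism_def)

lemma coord_image_open:
  assumes "a \<in> \<A>" "open V"
  shows "open (snd a ` (fst a \<inter> V))"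
proof -
  have "openin (top_of_set (fst a)) (fst a \<inter> V)" using assms(2) by (simp add: openin_open_Int)
  then have "openin (top_of_set (snd a ` fst a)) (snd a ` (fst a \<inter> V))"
    using homeomorphism_imp_open_map[OF chart_homeo[OF assms(1)]] by blast
  then show ?thesis using chart_image_open[OF assms(1)] openin_open_eq by blast
qed

lemma chart_at: "chart_at \<A> p \<in> \<A>" "p \<in> fst (chart_at \<A> p)"
proof -
  have "\<exists>a. a \<in> \<A> \<and> p \<in> fst a" using atlas unfolding oriented_atlas_def by blast
  from someI_ex[OF this] show "chart_at \<A> p \<in> \<A>" "p \<in> fst (chart_at \<A> p)" by (simp_all add: chart_at_def)
qed

lemma transition_has_derivative:
  assumes "a \<in> \<A>" "b \<in> \<A>" "q \<in> fst a" "q \<in> fst b"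
  shows "(transition a b has_derivative D a b q) (at (snd a q))"
proof -
  have "Ck_on (Suc 0) (snd a ` (fst a \<inter> fst b)) (transition a b)"
    using transition_smooth[OF assms(1,2)] by (auto simp only: smooth_on_def)
  from Ck_on_differentiable[OF coord_image_open[OF assms(1) chart_open[OF assms(2)]] this] show ?thesis
    using assms by blast
qed

lemma transition_self:
  assumes "a \<in> \<A>" "q \<in> fst a"
  shows "D a a q v = v"
proof -
  have "D a a q = frechet_derivative id (at (snd a q))"
    using assms by (intro frechet_derivative_cong_open[OF chart_image_open[OF assms(1)]])
      (auto simp: transition_def coord_inv)
  then show ?thesis by simp
qed

text \<open>The cocycle rule for the coordinate changes, which makes a vector given in one chart a tangent vector.\<close>

lemma transition_chain:
  assumes "a \<in> \<A>" "b \<in> \<A>" "c \<in> \<A>" "q \<in> fst a" "q \<in> fst b" "q \<in> fst c"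
  shows "D b c q (D a b q v) = D a c q v"
proof -
  let ?U = "snd a ` (fst a \<inter> (fst b \<inter> fst c))"
  have U: "open ?U" using assms by (intro coord_image_open open_Int chart_open)
  have x: "snd a q \<in> ?U" using assms by blast
  have b: "transition a b (snd a q) = snd b q" using assms by (simp add: transition_def coord_inv)
  have "((\<lambda>y. transition b c (transition a b y)) has_derivative (\<lambda>v. D b c q (D a b q v))) (at (snd a q))"
    using transition_has_derivative[of b c q] assms b
    by (intro has_derivative_compose[OF transition_has_derivative]) auto
  moreover have "transition b c (transition a b y) = transition a c y" if "y \<in> ?U" for y
    using that assms by (auto simp: transition_def coord_inv)
  ultimately have "(transition a c has_derivative (\<lambda>v. D b c q (D a b q v))) (at (snd a q))"
    using has_derivative_transform_within_open[OF _ U x] by blast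
  from frechet_derivative_at[OF this] show ?thesis by (simp add: fun_eq_iff)
qed

lemma tangent_space_iff:
  "w \<in> tangent_space \<A> p \<longleftrightarrow> fst w = p \<and> (\<forall>a. \<not> (a \<in> \<A> \<and> p \<in> fst a) \<longrightarrow> snd w a = 0) \<and>
     (\<forall>a\<in>\<A>. \<forall>b\<in>\<A>. p \<in> fst a \<and> p \<in> fst b \<longrightarrow> snd w b = D a b p (snd w a))"
  by (cases w) (auto simp: fibre_def tangent_bundle_def)

lemma tangent_base: "w \<in> tangent_space \<A> p \<Longrightarrow> fst w = p"
  and tangent_off: "w \<in> tangent_space \<A> p \<Longrightarrow> \<not> (a \<in> \<A> \<and> p \<in> fst a) \<Longrightarrow> snd w a = 0"
  and tangent_change: "w \<in> tangent_space \<A> p \<Longrightarrow> a \<in> \<A> \<Longrightarrow> b \<in> \<A> \<Longrightarrow> p \<in> fst a \<Longrightarrow> p \<in> fst b \<Longrightarrow>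
     snd w b = D a b p (snd w a)"
  unfolding tangent_space_iff by blast+

lemma D_linear: "a \<in> \<A> \<Longrightarrow> b \<in> \<A> \<Longrightarrow> q \<in> fst a \<Longrightarrow> q \<in> fst b \<Longrightarrow> linear (D a b q)"
  by (rule has_derivative_linear[OF transition_has_derivative])

lemma snd_tangent: "snd (badd T v w) a = snd v a + snd w a" "snd (bscl T c v) a = c *\<^sub>R snd v a"
  by (simp_all add: tangent_bundle_def)

lemma fst_tangent: "fst (badd T v w) = fst v" "fst (bscl T c v) = fst v"
  by (simp_all add: tangent_bundle_def)

lemma tangent_add:
  assumes v: "v \<in> tangent_space \<A> p" and w: "w \<in> tangent_space \<A> p"
  shows "badd T v w \<in> tangent_space \<A> p"
  unfolding tangent_space_iff snd_tangent fst_tangent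
proof (intro conjI allI ballI impI)
  fix a b assume "a \<in> \<A>" "b \<in> \<A>" "p \<in> fst a \<and> p \<in> fst b"
  then show "snd v b + snd w b = D a b p (snd v a + snd w a)"
    using tangent_change[OF v, of a b] tangent_change[OF w, of a b] linear_add[OF D_linear] by metis
qed (simp_all only: tangent_base[OF v] tangent_off[OF v] tangent_off[OF w] add_0_left not_False_eq_True)

lemma tangent_scale:
  assumes v: "v \<in> tangent_space \<A> p"
  shows "bscl T c v \<in> tangent_space \<A> p"
  unfolding tangent_space_iff snd_tangent fst_tangent
proof (intro conjI allI ballI impI)
  fix a b assume "a \<in> \<A>" "b \<in> \<A>" "p \<in> fst a \<and> p \<in> fst b"
  then show "c *\<^sub>R snd v b = D a b p (c *\<^sub>R snd v a)"
    using tangent_change[OF v, of a b] linear_cmul[OF D_linear] by metis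
qed (simp_all only: tangent_base[OF v] tangent_off[OF v] scaleR_zero_right not_False_eq_True)

lemma tangent_eqI:
  assumes v: "v \<in> tangent_space \<A> p" and w: "w \<in> tangent_space \<A> p"
    and a: "a \<in> \<A>" "p \<in> fst a" and eq: "snd v a = snd w a"
  shows "v = w"
proof (rule prod_eqI)
  show "fst v = fst w" by (simp only: tangent_base[OF v] tangent_base[OF w])
  show "snd v = snd w"
  proof
    fix b show "snd v b = snd w b"
    proof (cases "b \<in> \<A> \<and> p \<in> fst b")
      case True
      then show ?thesis using tangent_change[OF v a(1), of b] tangent_change[OF w a(1), of b] a(2) eq by simp
    next
      case False
      then show ?thesis by (simp only: tangent_off[OF v] tangent_off[OF w] not_False_eq_True)
    qed
  qed
qed

lemma const_field_tangent:
  assumes "a \<in> \<A>" "q \<in> fst a"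
  shows "const_field \<A> a v q \<in> tangent_space \<A> q"
  unfolding tangent_space_iff const_field_def using assms by (simp add: transition_chain)

lemma snd_const_field: "a \<in> \<A> \<Longrightarrow> q \<in> fst a \<Longrightarrow> snd (const_field \<A> a v q) a = snd v a"
  by (simp add: const_field_def transition_self)

lemma const_field_at: "a \<in> \<A> \<Longrightarrow> p \<in> fst a \<Longrightarrow> v \<in> tangent_space \<A> p \<Longrightarrow> const_field \<A> a v p = v"
  by (rule tangent_eqI[OF const_field_tangent]) (auto simp: snd_const_field)

text \<open>Seen in the chart \<open>b\<close> and in the coordinates of the chart \<open>c\<close>, a field with constant components in \<open>a\<close> is a
  derivative of the transition from \<open>a\<close> to \<open>b\<close>, composed with the transition from \<open>c\<close> to \<open>a\<close>.\<close>

lemma const_field_smooth: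
  assumes a: "a \<in> \<A>"
  shows "smooth_section \<A> T (fst a) (const_field \<A> a v)"
  unfolding smooth_section_def
proof (intro conjI ballI)
  show "const_field \<A> a v x \<in> tangent_space \<A> x" if "x \<in> fst a" for x
    using const_field_tangent[OF a that] .
  fix t assume "t \<in> trivs T"
  then obtain b where b: "b \<in> \<A>" and t: "t = (fst b, \<lambda>v. snd v b)" by (auto simp: tangent_bundle_def)
  show "smooth_map \<A> (fst t \<inter> fst a) (snd t \<circ> const_field \<A> a v)"
    unfolding smooth_map_def smooth_on_def
  proof (intro ballI allI)
    fix c k assume c: "c \<in> \<A>"
    let ?U = "snd c ` (fst c \<inter> (fst t \<inter> fst a))" and ?V = "snd a ` (fst a \<inter> fst b)"
    let ?f = "\<lambda>y. frechet_derivative (transition a b) (at y) (snd v a)"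
    have U: "open ?U" using a b c t by (auto intro!: coord_image_open open_Int chart_open)
    have V: "open ?V" using a b by (intro coord_image_open chart_open)
    have "Ck_on (Suc k) ?V (transition a b)"
      using transition_smooth[OF a b] by (auto simp only: smooth_on_def)
    then have f: "Ck_on k ?V ?f" by simp
    have "Ck_on k (snd c ` (fst c \<inter> fst a)) (transition c a)"
      using transition_smooth[OF c a] by (auto simp only: smooth_on_def)
    then have g: "Ck_on k ?U (transition c a)" by (rule Ck_on_subset) auto
    have "transition c a ` ?U \<subseteq> ?V"
      using a b c t by (auto simp: transition_def coord_inv)
    from Ck_on_compose[OF U V this f g] show "Ck_on k ?U (snd t \<circ> const_field \<A> a v \<circ> coord_inv c)"
      by (rule Ck_on_cong[OF U, rotated]) (use a b c t in \<open>auto simp: transition_def const_field_def coord_inv\<close>)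
  qed
qed

lemma deriv_along_cong:
  assumes "open V" "fst v \<in> V" "\<And>q. q \<in> V \<Longrightarrow> f q = h q"
  shows "deriv_along \<A> v f = deriv_along \<A> v h"
proof -
  let ?a = "chart_at \<A> (fst v)"
  have "frechet_derivative (f \<circ> coord_inv ?a) (at (snd ?a (fst v))) = frechet_derivative (h \<circ> coord_inv ?a) (at (snd ?a (fst v)))"
    using assms chart_at coord_image_open[of ?a V]
    by (intro frechet_derivative_cong_open[of "snd ?a ` (fst ?a \<inter> V)"]) (auto simp: coord_inv)
  then show ?thesis by (simp add: deriv_along_def Let_def)
qed

lemma smooth_map_has_derivative:
  assumes "smooth_map \<A> V f" "open V" "p \<in> V" "a \<in> \<A>" "p \<in> fst a"
  shows "(f \<circ> coord_inv a has_derivative frechet_derivative (f \<circ> coord_inv a) (at (snd a p))) (at (snd a p))"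
proof (rule Ck_on_differentiable)
  show "open (snd a ` (fst a \<inter> V))" using assms by (intro coord_image_open)
  show "Ck_on (Suc 0) (snd a ` (fst a \<inter> V)) (f \<circ> coord_inv a)"
    using assms unfolding smooth_map_def smooth_on_def by blast
qed (use assms in blast)

lemma deriv_along_linear:
  assumes "smooth_map \<A> V f" "open V" "fst v \<in> V" "bounded_linear L"
  shows "deriv_along \<A> v (\<lambda>q. L (f q)) = L (deriv_along \<A> v f)"
proof -
  let ?a = "chart_at \<A> (fst v)"
  have "((\<lambda>y. L ((f \<circ> coord_inv ?a) y)) has_derivative
      (\<lambda>u. L (frechet_derivative (f \<circ> coord_inv ?a) (at (snd ?a (fst v))) u))) (at (snd ?a (fst v)))"
    using assms chart_at by (intro bounded_linear.has_derivative[OF assms(4)] smooth_map_has_derivative)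
  from frechet_derivative_at[OF this] show ?thesis
    by (simp add: deriv_along_def Let_def o_def fun_eq_iff)
qed

lemma smooth_chart_component:
  assumes "a \<in> \<A>"
  shows "smooth_map \<A> (fst a) (\<lambda>q. snd a q $ i)"
  unfolding smooth_map_def smooth_on_def
proof (intro ballI allI)
  fix c k assume c: "c \<in> \<A>"
  have "Ck_on k (snd c ` (fst c \<inter> fst a)) (transition c a)"
    using transition_smooth[OF c assms] by (auto simp only: smooth_on_def)
  from Ck_on_linear[OF coord_image_open[OF c chart_open[OF assms]] bounded_linear_vec_nth this]
  show "Ck_on k (snd c ` (fst c \<inter> fst a)) ((\<lambda>q. snd a q $ i) \<circ> coord_inv c)"
    by (simp add: transition_def o_def)
qed

text \<open>The coordinates of a chart, as functions on its domain, detect the components of a tangent vector.  They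
  are the test functions to which the vanishing of the torsion is applied further below.\<close>

lemma deriv_along_chart_component:
  assumes "a \<in> \<A>" "q \<in> fst a" "w \<in> tangent_space \<A> q"
  shows "deriv_along \<A> w (\<lambda>x. snd a x $ i) = snd w a $ i"
proof -
  let ?b = "chart_at \<A> q"
  have "((\<lambda>y. transition ?b a y $ i) has_derivative (\<lambda>u. D ?b a q u $ i)) (at (snd ?b q))"
    using assms chart_at by (intro bounded_linear.has_derivative[OF bounded_linear_vec_nth] transition_has_derivative)
  from frechet_derivative_at[OF this]
  have "deriv_along \<A> w (\<lambda>x. snd a x $ i) = D ?b a q (snd w ?b) $ i"
    by (simp add: deriv_along_def Let_def tangent_base[OF assms(3)] transition_def o_def fun_eq_iff)
  moreover have "snd w a = D ?b a q (snd w ?b)"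
    using tangent_change[OF assms(3)] assms chart_at[of q] by blast
  ultimately show ?thesis by simp
qed

end


section \<open>Orthonormal frames\<close>

text \<open>Pairing with the family shows that the matrix with the columns \<open>E i\<close> has a trivial kernel.\<close>

lemma orthonormal_expansion:
  fixes E :: "'n::finite \<Rightarrow> real ^ 'n" and G :: "real ^ 'n \<Rightarrow> real ^ 'n \<Rightarrow> real"
  assumes G: "bilinear G" and E: "\<And>i j. G (E i) (E j) = (if i = j then 1 else 0)"
  shows "v = (\<Sum>i\<in>UNIV. G (E i) v *\<^sub>R E i)" and "det (\<chi> i j. E j $ i) \<noteq> 0"
proof -
  let ?A = "\<chi> i j. E j $ i"
  have A: "?A *v x = (\<Sum>j\<in>UNIV. x $ j *\<^sub>R E j)" for x
    by (simp add: matrix_vector_mult_def vec_eq_iff mult.commute)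
  have coeff: "G (E i) (?A *v x) = x $ i" for i x
    using G by (simp add: A bilinear_def linear_sum linear_cmul E if_distrib cong: if_cong)
  have "x = 0" if "?A *v x = 0" for x
    using coeff[of _ x] G unfolding that by (simp add: vec_eq_iff bilinear_rzero)
  then have inv: "invertible ?A"
    using invertible_left_inverse matrix_left_invertible_ker by blast
  then show "det ?A \<noteq> 0" by (simp add: invertible_det_nz)
  obtain B where "?A ** B = mat 1" using inv by (auto simp: invertible_def)
  then have "v = ?A *v (B *v v)" by (simp add: matrix_vector_mul_assoc)
  then obtain x where x: "v = ?A *v x" by blast
  show "v = (\<Sum>i\<in>UNIV. G (E i) v *\<^sub>R E i)"
    unfolding x coeff by (rule A)
qed

text \<open>The Gram-Schmidt process: as long as fewer vectors than the dimension are chosen, they do not span, and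
  the orthogonal part of a vector outside of their span can be normalised.\<close>

lemma orthonormal_family_exists:
  fixes G :: "real ^ 'n::finite \<Rightarrow> real ^ 'n \<Rightarrow> real"
  assumes G: "bilinear G" and sym: "\<And>v w. G v w = G w v" and pos: "\<And>v. v \<noteq> 0 \<Longrightarrow> G v v > 0"
  shows "\<exists>E :: 'n \<Rightarrow> real ^ 'n. \<forall>i\<in>F. \<forall>j\<in>F. G (E i) (E j) = (if i = j then 1 else 0)"
  using finite[of F]
proof (induction F rule: finite_induct)
  case (insert k F)
  then obtain E :: "'n \<Rightarrow> real ^ 'n" where E: "\<And>i j. i \<in> F \<Longrightarrow> j \<in> F \<Longrightarrow> G (E i) (E j) = (if i = j then 1 else 0)"
    by blast
  have lin: "linear (G v)" for v using G by (simp add: bilinear_def)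
  have "F \<noteq> UNIV" using insert.hyps by auto
  then have "card F < CARD('n)" by (metis finite psubset_card_mono subset_UNIV psubsetI)
  then have "card (E ` F) < CARD('n)" using card_image_le[of F E] by simp
  then have "span (E ` F) \<noteq> UNIV"
    using dim_le_card'[of "E ` F"] dim_span[of "E ` F"] by (metis dim_UNIV DIM_cart DIM_real finite finite_imageI
       mult.right_neutral not_le)
  then obtain v where v: "v \<notin> span (E ` F)" by blast
  define w where "w = v - (\<Sum>i\<in>F. G (E i) v *\<^sub>R E i)"
  have "(\<Sum>i\<in>F. G (E i) v *\<^sub>R E i) \<in> span (E ` F)"
    by (intro span_sum span_scale span_base) auto
  with v have "w \<noteq> 0" by (auto simp: w_def)
  then have w: "G w w > 0" by (rule pos)
  have orth: "G (E j) w = 0" if "j \<in> F" for j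
  proof -
    have "(\<Sum>i\<in>F. G (E i) v * G (E j) (E i)) = (\<Sum>i\<in>F. if i = j then G (E i) v else 0)"
      using that by (intro sum.cong) (auto simp: E)
    then show ?thesis
      using that insert.hyps by (simp add: w_def linear_diff[OF lin] linear_sum[OF lin] linear_cmul[OF lin])
  qed
  let ?u = "w /\<^sub>R sqrt (G w w)"
  have u: "G ?u ?u = 1" using w
    by (simp add: linear_cmul[OF lin] sym[of "_ *\<^sub>R _"] sym[of "_ /\<^sub>R _"] field_simps flip: real_sqrt_mult)
  have "G (E j) ?u = 0" "G ?u (E j) = 0" if "j \<in> F" for j
    using orth[OF that] by (simp_all add: sym[of _ "E j"] linear_cmul[OF lin])
  with u insert.hyps E show ?case
    by (intro exI[of _ "E(k := ?u)"]) auto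
qed simp

text \<open>Replacing one vector by its negative reverses the orientation.\<close>

lemma oriented_orthonormal_basis_exists:
  fixes G :: "real ^ 'n::finite \<Rightarrow> real ^ 'n \<Rightarrow> real"
  assumes G: "bilinear G" and sym: "\<And>v w. G v w = G w v" and pos: "\<And>v. v \<noteq> 0 \<Longrightarrow> G v v > 0"
  shows "\<exists>E :: 'n \<Rightarrow> real ^ 'n. (\<forall>i j. G (E i) (E j) = (if i = j then 1 else 0)) \<and> det (\<chi> i j. E j $ i) > 0"
proof -
  obtain E :: "'n \<Rightarrow> real ^ 'n" where E: "\<And>i j. G (E i) (E j) = (if i = j then 1 else 0)"
    using orthonormal_family_exists[OF assms, of UNIV] by blast
  show ?thesis
  proof (cases "det (\<chi> i j. E j $ i) > 0")
    case False
    fix k :: 'n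
    define E' where "E' = E(k := - E k)"
    have tr: "det (\<chi> i j. X j $ i) = det (\<chi> i. X i)" for X :: "'n \<Rightarrow> real ^ 'n"
      using det_transpose[of "\<chi> i. X i"] by (simp add: transpose_def)
    have eq: "(\<chi> i. E' i) = (\<chi> i. if i = k then (-1) *s E i else E i)" "(\<chi> i. E i) = (\<chi> i. if i = k then E i else E i)"
      by (auto simp: vec_eq_iff E'_def)
    have "det (\<chi> i j. E' j $ i) = - det (\<chi> i j. E j $ i)"
      unfolding tr eq(1) det_row_mul by (simp only: if_cancel)
    moreover have "det (\<chi> i j. E j $ i) \<noteq> 0" using orthonormal_expansion(2)[OF G E] .
    moreover have "G (E' i) (E' j) = (if i = j then 1 else 0)" for i j
      using G by (simp add: E'_def E bilinear_lneg bilinear_rneg)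
    ultimately show ?thesis using False by (intro exI[of _ E']) auto
  qed (use E in blast)
qed

locale riemannian_manifold = oriented_manifold \<A>
  for \<A> :: "'m::topological_space chart set" +
  fixes g :: "'m tangent \<Rightarrow> 'm tangent \<Rightarrow> real"
  assumes metric: "riemannian_metric \<A> g"
begin

lemma g_add: "u \<in> tangent_space \<A> p \<Longrightarrow> v \<in> tangent_space \<A> p \<Longrightarrow> w \<in> tangent_space \<A> p \<Longrightarrow>
    g (badd T u v) w = g u w + g v w"
  and g_scale: "v \<in> tangent_space \<A> p \<Longrightarrow> w \<in> tangent_space \<A> p \<Longrightarrow> g (bscl T c v) w = c * g v w"
  and g_sym: "v \<in> tangent_space \<A> p \<Longrightarrow> w \<in> tangent_space \<A> p \<Longrightarrow> g v w = g w v"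
  and g_pos: "v \<in> tangent_space \<A> p \<Longrightarrow> v \<noteq> zero_of T p \<Longrightarrow> g v v > 0"
  using metric[unfolded riemannian_metric_def Let_def, THEN conjunct1]
    metric[unfolded riemannian_metric_def Let_def, THEN conjunct2, THEN conjunct1]
  by blast+

text \<open>Coordinates on the tangent space, by which linear algebra in \<^typ>\<open>real ^ 4\<close> applies to it.\<close>

definition vec_at :: "'m \<Rightarrow> real ^ 4 \<Rightarrow> 'm tangent" where
  "vec_at p u = const_field \<A> (chart_at \<A> p) (p, \<lambda>_. u) p"

abbreviation comp_at :: "'m \<Rightarrow> 'm tangent \<Rightarrow> real ^ 4" where
  "comp_at p v \<equiv> snd v (chart_at \<A> p)"

lemma vec_at_tangent: "vec_at p u \<in> tangent_space \<A> p"
  unfolding vec_at_def by (intro const_field_tangent chart_at)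

lemma comp_vec_at: "comp_at p (vec_at p u) = u"
  unfolding vec_at_def by (simp add: snd_const_field chart_at)

lemma vec_comp_at: "v \<in> tangent_space \<A> p \<Longrightarrow> vec_at p (comp_at p v) = v"
  by (rule tangent_eqI[OF vec_at_tangent _ chart_at]) (simp_all add: comp_vec_at)

lemma vec_at_add: "vec_at p (u + w) = badd T (vec_at p u) (vec_at p w)"
  by (rule tangent_eqI[OF vec_at_tangent tangent_add[OF vec_at_tangent vec_at_tangent] chart_at])
     (simp only: comp_vec_at snd_tangent)

lemma vec_at_scale: "vec_at p (c *\<^sub>R u) = bscl T c (vec_at p u)"
  by (rule tangent_eqI[OF vec_at_tangent tangent_scale[OF vec_at_tangent] chart_at])
     (simp only: comp_vec_at snd_tangent)

lemma zero_tangent: "zero_of T p = vec_at p 0"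
  unfolding zero_of_def
proof (rule the_equality)
  show "vec_at p 0 \<in> tangent_space \<A> p \<and> badd T (vec_at p 0) (vec_at p 0) = vec_at p 0"
    using vec_at_add[of p 0 0] by (simp add: vec_at_tangent)
  fix z assume z: "z \<in> tangent_space \<A> p \<and> badd T z z = z"
  then have "comp_at p z = 0" by (metis add_cancel_left_left snd_tangent(1))
  then show "z = vec_at p 0" using z vec_comp_at[of z p] by simp
qed

lemma g_add_right: "u \<in> tangent_space \<A> p \<Longrightarrow> v \<in> tangent_space \<A> p \<Longrightarrow> w \<in> tangent_space \<A> p \<Longrightarrow>
    g w (badd T u v) = g w u + g w v"
  using g_add[of u p v w] g_sym[of w p] tangent_add[of u p v] by metis

lemma g_scale_right: "v \<in> tangent_space \<A> p \<Longrightarrow> w \<in> tangent_space \<A> p \<Longrightarrow> g w (bscl T c v) = c * g w v"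
  using g_scale[of v p w] g_sym[of w p] tangent_scale[of v p] by metis

lemma bilinear_chart_metric: "bilinear (\<lambda>u w. g (vec_at p u) (vec_at p w))"
  unfolding bilinear_def
  by (intro conjI allI linearI)
     (simp_all only: vec_at_add vec_at_scale g_add[OF vec_at_tangent vec_at_tangent vec_at_tangent]
        g_scale[OF vec_at_tangent vec_at_tangent] g_add_right[OF vec_at_tangent vec_at_tangent vec_at_tangent]
        g_scale_right[OF vec_at_tangent vec_at_tangent] real_scaleR_def)

lemma oriented_frame_exists: "\<exists>e. oriented_frame \<A> g p e"
proof -
  have "g (vec_at p v) (vec_at p w) = g (vec_at p w) (vec_at p v)" for v w
    using g_sym vec_at_tangent by blast
  moreover have "g (vec_at p v) (vec_at p v) > 0" if "v \<noteq> 0" for v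
    using that by (intro g_pos[OF vec_at_tangent]) (metis zero_tangent comp_vec_at)
  ultimately obtain E :: "4 \<Rightarrow> real ^ 4" where E: "\<And>i j. g (vec_at p (E i)) (vec_at p (E j)) = (if i = j then 1 else 0)"
    and det: "det (\<chi> i j. E j $ i) > 0"
    using oriented_orthonormal_basis_exists[OF bilinear_chart_metric[of p]] by blast
  let ?a = "chart_at \<A> p"
  have "det (\<chi> i j. snd (vec_at p (E j)) b $ i) > 0" if b: "b \<in> \<A>" "p \<in> fst b" for b
  proof -
    have "snd (vec_at p (E j)) b = matrix (D ?a b p) *v E j" for j
      using tangent_change[OF vec_at_tangent chart_at(1) b(1) chart_at(2) b(2)] D_linear[OF chart_at(1) b(1) chart_at(2) b(2)]
      by (simp add: comp_vec_at matrix_works)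
    then have "(\<chi> i j. snd (vec_at p (E j)) b $ i) = matrix (D ?a b p) ** (\<chi> i j. E j $ i)"
      by (simp add: vec_eq_iff matrix_vector_mult_def matrix_matrix_mult_def)
    then show ?thesis using det transition_det[OF chart_at(1) b(1) chart_at(2) b(2)] by (simp add: det_mul)
  qed
  then show ?thesis using E unfolding oriented_frame_def
    by (intro exI[of _ "\<lambda>i. vec_at p (E i)"]) (auto simp: vec_at_tangent)
qed

lemma oriented_frame_at: "oriented_frame \<A> g p (frame_at \<A> g p)"
  unfolding frame_at_def using oriented_frame_exists by (rule someI_ex)

lemma frame_tangent: "frame_at \<A> g p i \<in> tangent_space \<A> p"
  and frame_orthonormal: "g (frame_at \<A> g p i) (frame_at \<A> g p j) = (if i = j then 1 else 0)"
  using oriented_frame_at[of p] unfolding oriented_frame_def by blast+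

lemma frame_expansion:
  fixes f :: "'m tangent \<Rightarrow> real"
  assumes v: "v \<in> tangent_space \<A> p"
    and add: "\<And>v w. v \<in> tangent_space \<A> p \<Longrightarrow> w \<in> tangent_space \<A> p \<Longrightarrow> f (badd T v w) = f v + f w"
    and scale: "\<And>c v. v \<in> tangent_space \<A> p \<Longrightarrow> f (bscl T c v) = c * f v"
  shows "f v = (\<Sum>i\<in>UNIV. g (frame_at \<A> g p i) v * f (frame_at \<A> g p i))"
proof -
  let ?e = "frame_at \<A> g p" and ?u = "comp_at p v"
  have lin: "linear (\<lambda>u. f (vec_at p u))"
    by (intro linearI) (simp_all add: vec_at_add vec_at_scale add scale vec_at_tangent)
  have vec: "vec_at p (comp_at p (?e i)) = ?e i" for i
    using frame_tangent by (rule vec_comp_at)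
  have "?u = (\<Sum>i\<in>UNIV. g (vec_at p (comp_at p (?e i))) (vec_at p ?u) *\<^sub>R comp_at p (?e i))"
    by (rule orthonormal_expansion(1)[OF bilinear_chart_metric]) (simp add: vec frame_orthonormal)
  then have "?u = (\<Sum>i\<in>UNIV. g (?e i) v *\<^sub>R comp_at p (?e i))"
    unfolding vec vec_comp_at[OF v] .
  then have "f (vec_at p ?u) = f (vec_at p (\<Sum>i\<in>UNIV. g (?e i) v *\<^sub>R comp_at p (?e i)))"
    by (rule arg_cong[where f = "\<lambda>u. f (vec_at p u)"])
  moreover have "f (vec_at p (\<Sum>i\<in>UNIV. g (?e i) v *\<^sub>R comp_at p (?e i))) =
      (\<Sum>i\<in>UNIV. g (?e i) v * f (vec_at p (comp_at p (?e i))))"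
    unfolding linear_sum[OF lin] linear_cmul[OF lin] real_scaleR_def by (rule refl)
  ultimately show ?thesis unfolding vec vec_comp_at[OF v] by (rule trans)
qed

end


section \<open>The Hodge star in a frame\<close>

lemma sum_permutations_4:
  fixes f :: "4 \<Rightarrow> 4 \<Rightarrow> 4 \<Rightarrow> 4 \<Rightarrow> real"
  shows "(\<Sum>\<pi> | \<pi> permutes (UNIV :: 4 set). of_int (sign \<pi>) * f (\<pi> 1) (\<pi> 2) (\<pi> 3) (\<pi> 4)) =
      f 1 2 3 4 + f 1 3 4 2 + f 1 4 2 3 - f 1 2 4 3 - f 1 3 2 4 - f 1 4 3 2
    - f 2 1 3 4 - f 2 3 4 1 - f 2 4 1 3 + f 2 1 4 3 + f 2 3 1 4 + f 2 4 3 1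
    + f 3 1 2 4 + f 3 2 4 1 + f 3 4 1 2 - f 3 1 4 2 - f 3 2 1 4 - f 3 4 2 1
    - f 4 1 2 3 - f 4 2 3 1 - f 4 3 1 2 + f 4 1 3 2 + f 4 2 1 3 + f 4 3 2 1"
proof -
  have f1234: "finite {2::4, 3, 4}" "1 \<notin> {2::4, 3, 4}" by auto
  have f234: "finite {3::4, 4}" "2 \<notin> {3::4, 4}" by auto
  have f34: "finite {4::4}" "3 \<notin> {4::4}" by auto
  show ?thesis
    unfolding UNIV_4
    unfolding sum_over_permutations_insert[OF f1234]
    unfolding sum_over_permutations_insert[OF f234]
    unfolding sum_over_permutations_insert[OF f34]
    unfolding permutes_sing
    by (simp add: sign_swap_id permutation_swap_id permutation_compose sign_compose sign_id Transposition.transpose_def)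
qed

context riemannian_manifold
begin

lemma vectors_at_1: "vs \<in> vectors_at \<A> 1 p \<longleftrightarrow> (\<exists>v. vs = [v] \<and> v \<in> tangent_space \<A> p)"
  and vectors_at_2: "vs \<in> vectors_at \<A> 2 p \<longleftrightarrow> (\<exists>v w. vs = [v, w] \<and> v \<in> tangent_space \<A> p \<and> w \<in> tangent_space \<A> p)"
  by (auto simp: vectors_at_def numeral_eq_Suc length_Suc_conv)

lemma alternating_2_anti:
  assumes \<alpha>: "\<alpha> \<in> alternating_at \<A> 2 p" and v: "v \<in> tangent_space \<A> p" and w: "w \<in> tangent_space \<A> p"
  shows "\<alpha> [v, w] = - \<alpha> [w, v]"
proof -
  have mem: "[x, y] \<in> vectors_at \<A> 2 p" if "x \<in> tangent_space \<A> p" "y \<in> tangent_space \<A> p" for x y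
    using that by (simp add: vectors_at_2)
  note vw = tangent_add[OF v w]
  have alt: "\<alpha> [x, x] = 0" if "x \<in> tangent_space \<A> p" for x
  proof -
    have "\<forall>i<2. \<forall>j<2. i \<noteq> j \<and> [x, x] ! i = [x, x] ! j \<longrightarrow> \<alpha> [x, x] = 0"
      using \<alpha> mem[OF that that] unfolding alternating_at_def by blast
    from this[rule_format, of 0 1] show ?thesis by simp
  qed
  have l: "\<alpha> [badd T v w, x] = \<alpha> [v, x] + \<alpha> [w, x]" and r: "\<alpha> [x, badd T v w] = \<alpha> [x, v] + \<alpha> [x, w]"
    if x: "x \<in> tangent_space \<A> p" for x
  proof -
    have "\<alpha> ([x, x][i := badd T v w]) = \<alpha> ([x, x][i := v]) + \<alpha> ([x, x][i := w])" if "i < 2" for i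
      using \<alpha> mem[OF x x] v w that unfolding alternating_at_def by blast
    from this[of 0] this[of 1] show "\<alpha> [badd T v w, x] = \<alpha> [v, x] + \<alpha> [w, x]" "\<alpha> [x, badd T v w] = \<alpha> [x, v] + \<alpha> [x, w]"
      by simp_all
  qed
  show ?thesis using alt[OF vw] alt[OF v] alt[OF w] by (simp add: l[OF vw] r[OF v] r[OF w])
qed

text \<open>Each of the six summands collects four of the 24 permutations: exchanging the two entries of \<open>\<beta>\<close> changes both
  the sign of the permutation and that of \<open>\<beta>\<close>, which cancels the factor \<open>1/2!\<close>.\<close>

lemma hodge_2:
  assumes \<beta>: "\<beta> \<in> alternating_at \<A> 2 p" and v: "v \<in> tangent_space \<A> p" and w: "w \<in> tangent_space \<A> p"
  defines "e \<equiv> frame_at \<A> g p"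
  shows "hodge_at \<A> g 2 p \<beta> [v, w] =
    \<beta> [e 1, e 2] * (g (e 3) v * g (e 4) w - g (e 4) v * g (e 3) w) +
    \<beta> [e 3, e 4] * (g (e 1) v * g (e 2) w - g (e 2) v * g (e 1) w) +
    \<beta> [e 1, e 3] * (g (e 4) v * g (e 2) w - g (e 2) v * g (e 4) w) +
    \<beta> [e 4, e 2] * (g (e 1) v * g (e 3) w - g (e 3) v * g (e 1) w) +
    \<beta> [e 1, e 4] * (g (e 2) v * g (e 3) w - g (e 3) v * g (e 2) w) +
    \<beta> [e 2, e 3] * (g (e 1) v * g (e 4) w - g (e 4) v * g (e 1) w)"
proof -
  have anti: "\<beta> [e i, e j] = - \<beta> [e j, e i]" for i j
    unfolding e_def by (rule alternating_2_anti[OF \<beta> frame_tangent frame_tangent])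
  have "[v, w] \<in> vectors_at \<A> (4 - 2) p" using v w by (simp add: vectors_at_2)
  then have *: "hodge_at \<A> g 2 p \<beta> [v, w] = (\<Sum>\<pi> | \<pi> permutes (UNIV :: 4 set). of_int (sign \<pi>) *
      (\<beta> [e (\<pi> 1), e (\<pi> 2)] * (g (e (\<pi> 3)) v * g (e (\<pi> 4)) w))) / 2"
    by (simp add: hodge_at_def Let_def mult.assoc e_def)
  show ?thesis
    unfolding * sum_permutations_4[of "\<lambda>i j k l. \<beta> [e i, e j] * (g (e k) v * g (e l) w)"]
      anti[of 2 1] anti[of 3 1] anti[of 4 1] anti[of 3 2] anti[of 2 4] anti[of 4 3]
    by (simp add: field_simps)
qed

text \<open>The star of a 3-form on \<open>e l\<close> only sees the permutations that end in \<open>l\<close>; by antisymmetry all six of them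
  contribute the same, which cancels the factor \<open>1/3!\<close>.\<close>

lemma hodge_3:
  fixes p :: 'm
  defines "e \<equiv> frame_at \<A> g p"
  assumes anti: "\<And>i j k. \<beta> [e j, e i, e k] = - \<beta> [e i, e j, e k]" "\<And>i j k. \<beta> [e i, e k, e j] = - \<beta> [e i, e j, e k]"
  shows "hodge_at \<A> g 3 p \<beta> [e 1] = - \<beta> [e 2, e 3, e 4]" "hodge_at \<A> g 3 p \<beta> [e 2] = \<beta> [e 1, e 3, e 4]"
    "hodge_at \<A> g 3 p \<beta> [e 3] = - \<beta> [e 1, e 2, e 4]" "hodge_at \<A> g 3 p \<beta> [e 4] = \<beta> [e 1, e 2, e 3]"
proof -
  have perm: "\<beta> [e j, e i, e k] = - \<beta> [e i, e j, e k]" "\<beta> [e i, e k, e j] = - \<beta> [e i, e j, e k]"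
    "\<beta> [e j, e k, e i] = \<beta> [e i, e j, e k]" "\<beta> [e k, e i, e j] = \<beta> [e i, e j, e k]"
    "\<beta> [e k, e j, e i] = - \<beta> [e i, e j, e k]" for i j k
    using anti by (metis minus_minus)+
  have "hodge_at \<A> g 3 p \<beta> [e l] = (\<Sum>\<pi> | \<pi> permutes (UNIV :: 4 set). of_int (sign \<pi>) *
      (\<beta> [e (\<pi> 1), e (\<pi> 2), e (\<pi> 3)] * (if \<pi> 4 = l then 1 else 0))) / 6" for l
  proof -
    have "[e l] \<in> vectors_at \<A> (4 - 3) p" using frame_tangent by (simp add: vectors_at_def e_def)
    then show ?thesis
      by (simp add: hodge_at_def Let_def mult.assoc fact_numeral e_def frame_orthonormal)
  qed
  note sum = this[unfolded sum_permutations_4[of "\<lambda>i j k m. \<beta> [e i, e j, e k] * (if m = _ then 1 else 0)"]]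
  show "hodge_at \<A> g 3 p \<beta> [e 1] = - \<beta> [e 2, e 3, e 4]" "hodge_at \<A> g 3 p \<beta> [e 2] = \<beta> [e 1, e 3, e 4]"
    "hodge_at \<A> g 3 p \<beta> [e 3] = - \<beta> [e 1, e 2, e 4]" "hodge_at \<A> g 3 p \<beta> [e 4] = \<beta> [e 1, e 2, e 3]"
    by (simp_all add: sum perm[where i = 1 and j = 2 and k = 3] perm[where i = 1 and j = 2 and k = 4]
        perm[where i = 1 and j = 3 and k = 4] perm[where i = 2 and j = 3 and k = 4])
qed

lemma self_dual_components:
  assumes \<alpha>: "\<alpha> \<in> self_dual_at \<A> g p"
  defines "e \<equiv> frame_at \<A> g p"
  shows "\<alpha> [e 3, e 4] = \<alpha> [e 1, e 2]" "\<alpha> [e 4, e 2] = \<alpha> [e 1, e 3]" "\<alpha> [e 2, e 3] = \<alpha> [e 1, e 4]"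
proof -
  have alt: "\<alpha> \<in> alternating_at \<A> 2 p" and h: "hodge_at \<A> g 2 p \<alpha> = \<alpha>"
    using \<alpha> by (simp_all add: self_dual_at_def)
  note h2 = hodge_2[OF alt frame_tangent frame_tangent, unfolded h]
  show "\<alpha> [e 3, e 4] = \<alpha> [e 1, e 2]" "\<alpha> [e 4, e 2] = \<alpha> [e 1, e 3]" "\<alpha> [e 2, e 3] = \<alpha> [e 1, e 4]"
    using h2[of 3 4] h2[of 4 2] h2[of 2 3] by (simp_all add: frame_orthonormal e_def)
qed

text \<open>A self-dual form is the star of itself, and the star of a form is expressed by the components of the form in
  the frame; so three components determine it.\<close>

lemma self_dual_eqI:
  assumes \<alpha>: "\<alpha> \<in> self_dual_at \<A> g p" and \<beta>: "\<beta> \<in> self_dual_at \<A> g p"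
  defines "e \<equiv> frame_at \<A> g p"
  assumes eq: "\<alpha> [e 1, e 2] = \<beta> [e 1, e 2]" "\<alpha> [e 1, e 3] = \<beta> [e 1, e 3]" "\<alpha> [e 1, e 4] = \<beta> [e 1, e 4]"
  shows "\<alpha> = \<beta>"
proof
  have alt: "\<alpha> \<in> alternating_at \<A> 2 p" "\<beta> \<in> alternating_at \<A> 2 p"
    and h: "hodge_at \<A> g 2 p \<alpha> = \<alpha>" "hodge_at \<A> g 2 p \<beta> = \<beta>"
    using \<alpha> \<beta> by (simp_all add: self_dual_at_def)
  note sd = self_dual_components[OF \<alpha>, folded e_def] self_dual_components[OF \<beta>, folded e_def]
  fix vs show "\<alpha> vs = \<beta> vs"
  proof (cases "vs \<in> vectors_at \<A> 2 p")
    case True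
    then obtain v w where vs: "vs = [v, w]" and v: "v \<in> tangent_space \<A> p" and w: "w \<in> tangent_space \<A> p"
      by (auto simp: vectors_at_2)
    show ?thesis
      using hodge_2[OF alt(1) v w, unfolded h]
        hodge_2[OF alt(2) v w, unfolded h]
      by (simp add: vs sd eq flip: e_def)
  next
    case False
    then show ?thesis using alt unfolding alternating_at_def by simp
  qed
qed

text \<open>Conversely, the three relations between the components suffice for self-duality, because a bilinear form
  can be expanded in the frame.\<close>

lemma self_dual_from_components:
  fixes s :: "'m tangent \<Rightarrow> 'm tangent \<Rightarrow> real"
  assumes add: "\<And>u v w. u \<in> tangent_space \<A> p \<Longrightarrow> v \<in> tangent_space \<A> p \<Longrightarrow> w \<in> tangent_space \<A> p \<Longrightarrow>
      s (badd T u v) w = s u w + s v w"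
    and scale: "\<And>c v w. v \<in> tangent_space \<A> p \<Longrightarrow> w \<in> tangent_space \<A> p \<Longrightarrow> s (bscl T c v) w = c * s v w"
    and anti: "\<And>v w. v \<in> tangent_space \<A> p \<Longrightarrow> w \<in> tangent_space \<A> p \<Longrightarrow> s v w = - s w v"
  defines "e \<equiv> frame_at \<A> g p"
  assumes sd: "s (e 3) (e 4) = s (e 1) (e 2)" "s (e 4) (e 2) = s (e 1) (e 3)" "s (e 2) (e 3) = s (e 1) (e 4)"
  shows "(\<lambda>vs. if vs \<in> vectors_at \<A> 2 p then s (vs ! 0) (vs ! 1) else 0) \<in> self_dual_at \<A> g p" (is "?\<alpha> \<in> _")
proof -
  have mem: "[v, w] \<in> vectors_at \<A> 2 p" if "v \<in> tangent_space \<A> p" "w \<in> tangent_space \<A> p" for v w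
    using that by (simp add: vectors_at_2)
  have \<alpha>: "?\<alpha> [v, w] = s v w" if "v \<in> tangent_space \<A> p" "w \<in> tangent_space \<A> p" for v w
    using mem[OF that] by simp
  have add': "s w (badd T u v) = s w u + s w v"
    if "u \<in> tangent_space \<A> p" "v \<in> tangent_space \<A> p" "w \<in> tangent_space \<A> p" for u v w
    using add[OF that] anti[OF that(3) tangent_add[OF that(1,2)]] anti[OF that(3,1)] anti[OF that(3,2)] by simp
  have scale': "s w (bscl T c v) = c * s w v" if "v \<in> tangent_space \<A> p" "w \<in> tangent_space \<A> p" for c v w
    using scale[OF that] anti[OF that(2) tangent_scale[OF that(1)]] anti[OF that(2,1)] by simp
  have e: "e i \<in> tangent_space \<A> p" for i unfolding e_def by (rule frame_tangent)
  have s0: "s v v = 0" if "v \<in> tangent_space \<A> p" for v using anti[OF that that] by simp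
  have alt: "?\<alpha> \<in> alternating_at \<A> 2 p"
    unfolding alternating_at_def mem_Collect_eq
  proof (intro conjI ballI allI impI)
    fix vs i v w c
    assume vs: "vs \<in> vectors_at \<A> 2 p" and i: "i < (2::nat)" and v: "v \<in> tangent_space \<A> p" and w: "w \<in> tangent_space \<A> p"
    obtain x y where xy: "vs = [x, y]" "x \<in> tangent_space \<A> p" "y \<in> tangent_space \<A> p" using vs by (auto simp: vectors_at_2)
    have "i = 0 \<or> i = 1" using i by auto
    then show "?\<alpha> (vs[i := badd T v w]) = ?\<alpha> (vs[i := v]) + ?\<alpha> (vs[i := w])" "?\<alpha> (vs[i := bscl T c v]) = c * ?\<alpha> (vs[i := v])"
      using xy(2,3) v w tangent_add[OF v w] tangent_scale[OF v, of c] unfolding xy(1)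
      by (elim disjE; simp add: mem add add' scale scale')+
  next
    fix vs :: "'m tangent list" and i j :: nat
    assume vs: "vs \<in> vectors_at \<A> 2 p" and i: "i < 2" and j: "j < 2" and ij: "i \<noteq> j \<and> vs ! i = vs ! j"
    obtain x y where xy: "vs = [x, y]" "x \<in> tangent_space \<A> p" "y \<in> tangent_space \<A> p" using vs by (auto simp: vectors_at_2)
    have "x = y" using i j ij xy(1) by (auto simp: less_2_cases_iff)
    then show "?\<alpha> vs = 0" using xy s0 by simp
  qed simp
  have "hodge_at \<A> g 2 p ?\<alpha> vs = ?\<alpha> vs" for vs
  proof (cases "vs \<in> vectors_at \<A> 2 p")
    case True
    then obtain v w where vs: "vs = [v, w]" and v: "v \<in> tangent_space \<A> p" and w: "w \<in> tangent_space \<A> p"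
      by (auto simp: vectors_at_2)
    have "s v w = (\<Sum>i\<in>UNIV. g (e i) v * s (e i) w)"
      unfolding e_def by (rule frame_expansion[OF v]) (simp_all add: add scale w)
    moreover have "s (e i) w = (\<Sum>j\<in>UNIV. g (e j) w * s (e i) (e j))" for i
      unfolding e_def by (rule frame_expansion[OF w]) (simp_all add: add' scale' frame_tangent)
    ultimately have "s v w = (\<Sum>i\<in>UNIV. g (e i) v * (\<Sum>j\<in>UNIV. g (e j) w * s (e i) (e j)))" by simp
    moreover have "s (e 2) (e 1) = - s (e 1) (e 2)" "s (e 3) (e 1) = - s (e 1) (e 3)" "s (e 4) (e 1) = - s (e 1) (e 4)"
      "s (e 3) (e 2) = - s (e 1) (e 4)" "s (e 2) (e 4) = - s (e 1) (e 3)" "s (e 4) (e 3) = - s (e 1) (e 2)"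
      using anti[OF e e] sd by metis+
    moreover have "hodge_at \<A> g 2 p ?\<alpha> [v, w] =
        s (e 1) (e 2) * (g (e 3) v * g (e 4) w - g (e 4) v * g (e 3) w) +
        s (e 3) (e 4) * (g (e 1) v * g (e 2) w - g (e 2) v * g (e 1) w) +
        s (e 1) (e 3) * (g (e 4) v * g (e 2) w - g (e 2) v * g (e 4) w) +
        s (e 4) (e 2) * (g (e 1) v * g (e 3) w - g (e 3) v * g (e 1) w) +
        s (e 1) (e 4) * (g (e 2) v * g (e 3) w - g (e 3) v * g (e 2) w) +
        s (e 2) (e 3) * (g (e 1) v * g (e 4) w - g (e 4) v * g (e 1) w)"
      using hodge_2[OF alt v w, folded e_def]
      unfolding \<alpha>[OF e e] .
    ultimately show ?thesis unfolding vs \<alpha>[OF v w] sum_4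
      by (simp add: s0[OF e] sd algebra_simps)
  next
    case False
    then show ?thesis by (simp add: hodge_at_def)
  qed
  with alt show ?thesis unfolding self_dual_at_def by blast
qed

end


section \<open>Clifford algebra of an oriented frame\<close>

text \<open>Clifford multiplication by the four vectors of an oriented orthonormal frame, in coordinates of the spinor spaces:
  \<open>P i\<close> and \<open>M i\<close> are the actions of \<open>e i\<close> on positive and on negative spinors, and \<open>H\<close> is the Hermitian metric of the
  positive ones.\<close>

locale clifford_frame =
  fixes P M :: "4 \<Rightarrow> complex ^ 2 \<Rightarrow> complex ^ 2"
    and H :: "complex ^ 2 \<Rightarrow> complex ^ 2 \<Rightarrow> complex"
  assumes P_add: "P i (a + b) = P i a + P i b"
    and P_scale: "P i (z *s a) = z *s P i a"
    and M_add: "M i (b + b') = M i b + M i b'"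
    and M_scale: "M i (z *s b) = z *s M i b"
    and MP_self: "M i (P i a) = - a"
    and PM_self: "P i (M i b) = - b"
    and MP_anti: "i \<noteq> j \<Longrightarrow> M i (P j a) = - M j (P i a)"
    and PM_anti: "i \<noteq> j \<Longrightarrow> P i (M j b) = - P j (M i b)"
    and volume: "M 1 (P 2 (M 3 (P 4 a))) = - a"
    and H_add: "H (a + a') b = H a b + H a' b"
    and H_scale: "H (z *s a) b = z * H a b"
    and H_herm: "H a b = cnj (H b a)"
    and H_adjoint: "H (M i (P j a)) b = H a (M j (P i b))"
begin

lemma P_minus: "P i (- a) = - P i a" and M_minus: "M i (- b) = - M i b"
  using P_scale[of i "-1" a] M_scale[of i "-1" b] by (simp_all add: vector_sneg_minus1[symmetric])

text \<open>Since the volume element acts as \<open>-1\<close>, complementary products of two frame vectors agree on positive spinors.  So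
  \<open>\<Lambda>\<^sup>2\<close> acts through its self-dual part, which the three operators \<open>I\<close>, \<open>J\<close>, \<open>K\<close> below represent.\<close>

lemma MP_34: "M 3 (P 4 a) = M 1 (P 2 a)"
proof -
  have "P 1 (M 1 (P 2 (M 3 (P 4 a)))) = P 1 (- a)" by (simp only: volume)
  then have "P 2 (M 3 (P 4 a)) = P 1 a" by (simp add: PM_self P_minus)
  then have "M 2 (P 2 (M 3 (P 4 a))) = M 2 (P 1 a)" by simp
  then show ?thesis by (simp add: MP_self MP_anti[of 2 1]) 
qed

lemma MP_42: "M 4 (P 2 a) = M 1 (P 3 a)"
proof -
  have "P 4 (M 3 (P 4 a)) = P 3 a"
    by (simp add: PM_anti[of 4 3] MP_self P_minus)
  moreover have "P 4 (M 1 (P 2 a)) = - P 1 (M 4 (P 2 a))" by (simp add: PM_anti[of 4 1])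
  ultimately have "M 1 (P 3 a) = M 1 (- P 1 (M 4 (P 2 a)))" by (simp add: MP_34)
  then show ?thesis by (simp add: M_minus MP_self)
qed

lemma MP_23: "M 2 (P 3 a) = M 1 (P 4 a)"
proof -
  have "P 3 (M 3 (P 4 a)) = - P 4 a" by (simp add: PM_self)
  moreover have "P 3 (M 1 (P 2 a)) = P 1 (M 2 (P 3 a))"
    by (simp add: PM_anti[of 3 1] MP_anti[of 3 2] P_minus)
  ultimately have "M 1 (P 1 (M 2 (P 3 a))) = M 1 (- P 4 a)" by (simp add: MP_34)
  then show ?thesis by (simp add: M_minus MP_self)
qed

abbreviation "I a \<equiv> M 1 (P 2 a)"
abbreviation "J a \<equiv> M 1 (P 3 a)"
abbreviation "K a \<equiv> M 1 (P 4 a)"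

lemma I_I: "I (I a) = - a" and J_J: "J (J a) = - a"
  by (simp_all add: PM_anti[of 2 1] PM_anti[of 3 1] MP_self M_minus P_minus)

lemma I_J: "I (J a) = K a"
proof -
  have "I (J a) = - M 1 (P 1 (M 2 (P 3 a)))" by (simp add: PM_anti[of 2 1] M_minus)
  then show ?thesis by (simp add: MP_self MP_23)
qed

lemma J_I: "J (I a) = - K a"
proof -
  have "J (I a) = - M 1 (P 1 (M 3 (P 2 a)))" by (simp add: PM_anti[of 3 1] M_minus)
  then show ?thesis by (simp add: MP_self MP_23 MP_anti[of 3 2])
qed

lemma IJK_add: "I (a + b) = I a + I b" "J (a + b) = J a + J b" "K (a + b) = K a + K b"
  and IJK_scale: "I (z *s a) = z *s I a" "J (z *s a) = z *s J a" "K (z *s a) = z *s K a"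
  by (simp_all add: P_add M_add P_scale M_scale)

text \<open>The quaternion relations force the standard form of the three operators: \<open>J\<close> exchanges the eigenspaces of \<open>I\<close>
  for \<open>\<i>\<close> and \<open>-\<i>\<close>, so both are lines.  This is where the rank of the spinor bundle enters.\<close>

lemma quaternion_basis:
  obtains u v where "u \<noteq> 0" "I u = \<i> *s u" "J u = v" "K u = - \<i> *s v"
    "I v = - \<i> *s v" "J v = - u" "K v = - \<i> *s u" "\<And>a. \<exists>s t. a = s *s u + t *s v"
proof -
  have "\<exists>u. u \<noteq> 0 \<and> I u = \<i> *s u"
  proof -
    \<comment> \<open>\<open>w - \<i> I w\<close> is an eigenvector of \<open>I\<close> for \<open>\<i>\<close>; if it vanishes, then \<open>w\<close> is one for \<open>-\<i>\<close>, and \<open>J w\<close> takes its role\<close>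
    define w :: "complex ^ 2" where "w = axis 1 1"
    have w: "w \<noteq> 0" by (simp add: w_def)
    show ?thesis
    proof (cases "w + (- \<i>) *s I w = 0")
      case False
      have "I (w + (- \<i>) *s I w) = \<i> *s (w + (- \<i>) *s I w)"
        unfolding IJK_add IJK_scale I_I by (simp add: vec_eq_iff algebra_simps)
      with False show ?thesis by blast
    next
      case True
      then have Iw: "I w = - \<i> *s w"
        by (simp add: vec_eq_iff algebra_simps)
      have "J w \<noteq> 0" using w J_J[of w] P_scale[of 3 0 w] M_scale[of 1 0 "P 3 w"]
        by (metis P_scale M_scale neg_equal_0_iff_equal vector_smult_lzero)
      moreover have "I (J w) = \<i> *s J w"
      proof -
        have "I (J w) = - J (I w)" by (simp add: I_J J_I)
        then show ?thesis unfolding Iw by (simp add: IJK_scale P_minus M_minus vec_eq_iff)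
      qed
      ultimately show ?thesis by blast
    qed
  qed
  then obtain u where u: "u \<noteq> 0" "I u = \<i> *s u" by blast
  define v where "v = J u"
  have Jv: "J v = - u" by (simp add: v_def J_J)
  have Ku: "K u = - \<i> *s v" using J_I[of u] by (simp add: u v_def IJK_scale vec_eq_iff)
  have Iv: "I v = - \<i> *s v" using I_J[of u] Ku by (simp add: v_def)
  have Kv: "K v = - \<i> *s u"
    using I_J[of v] u(2) by (simp add: Jv P_minus M_minus vec_eq_iff)
  \<comment> \<open>linear independence as a nonzero determinant, so that Cramer's rule gives the coefficients\<close>
  have ind: "u $ 1 * v $ 2 - u $ 2 * v $ 1 \<noteq> 0"
  proof
    assume det: "u $ 1 * v $ 2 - u $ 2 * v $ 1 = 0"
    have "\<exists>l. v = l *s u"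
    proof (cases "u $ 1 = 0")
      case True
      then have "u $ 2 \<noteq> 0" using u(1) by (auto simp: vec_eq_iff forall_2)
      with True det have "v = (v $ 2 / u $ 2) *s u" by (simp add: vec_eq_iff forall_2)
      then show ?thesis by blast
    next
      case False
      then have "v = (v $ 1 / u $ 1) *s u" using det
        by (simp add: vec_eq_iff forall_2 field_simps)
      then show ?thesis by blast
    qed
    then obtain l where l: "v = l *s u" by blast
    have "\<i> *s v = - \<i> *s v" using Iv unfolding l IJK_scale u by (simp add: vec_eq_iff mult.left_commute)
    then have "v = 0" by (simp add: vec_eq_iff)
    then have "P 3 v = 0" using P_scale[of 3 0 0] by simp
    then have "J v = 0" using M_scale[of 1 0 0] by simp
    with Jv u show False by simp
  qed
  have "\<exists>s t. a = s *s u + t *s v" for a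
  proof -
    let ?D = "u $ 1 * v $ 2 - u $ 2 * v $ 1"
    have "a = ((a $ 1 * v $ 2 - a $ 2 * v $ 1) / ?D) *s u + ((u $ 1 * a $ 2 - u $ 2 * a $ 1) / ?D) *s v"
      using ind by (simp add: vec_eq_iff forall_2 divide_simps) (simp add: algebra_simps)
    then show ?thesis by blast
  qed
  then show thesis using that[of u v] u Jv Ku Iv Kv v_def by blast
qed

lemma quaternion_independent:
  fixes x y z :: real
  assumes "\<And>a. of_real x *s I a + of_real y *s J a + of_real z *s K a = 0"
  shows "x = 0" "y = 0" "z = 0"
proof -
  obtain u v where uv: "u \<noteq> 0" "I u = \<i> *s u" "J u = v" "K u = - \<i> *s v"
    "I v = - \<i> *s v" "J v = - u" "K v = - \<i> *s u"
    by (rule quaternion_basis) blast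
  have "v \<noteq> 0"
  proof
    assume "v = 0"
    with IJK_scale(2)[of 0 0] uv show False by simp
  qed
  have I_0: "I 0 = 0" using IJK_scale(1)[of 0 0] by simp
  have 1: "of_real x *s (\<i> *s u) + of_real y *s v + of_real z *s (- \<i> *s v) = 0"
    using assms[of u] unfolding uv .
  \<comment> \<open>\<open>I\<close> multiplies the two eigenvectors by \<open>\<i>\<close> and \<open>-\<i>\<close>, so the relation splits into its components along \<open>u\<close> and \<open>v\<close>\<close>
  have 2: "of_real x *s (\<i> *s (\<i> *s u)) + of_real y *s (- \<i> *s v) + of_real z *s (- \<i> *s (- \<i> *s v)) = 0"
    using arg_cong[OF 1, of I] unfolding IJK_add IJK_scale uv I_0 .
  have "(2 * of_real x) *s u = 0"
  proof -
    have "2 * of_real x * u $ k = 0" for k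
      using arg_cong[OF 1, of "\<lambda>v. v $ k"] arg_cong[OF 2, of "\<lambda>v. v $ k"] i_squared
      by (simp only: vector_add_component vector_smult_component zero_index) algebra
    then show ?thesis by (simp add: vec_eq_iff)
  qed
  with \<open>u \<noteq> 0\<close> show "x = 0" by (auto simp: vec_eq_iff)
  with 1 have "(of_real y - \<i> * of_real z) *s v = 0" by (simp add: vec_eq_iff algebra_simps)
  with \<open>v \<noteq> 0\<close> have "of_real y - \<i> * of_real z = (0::complex)" by (auto simp: vec_eq_iff)
  then show "y = 0" "z = 0" by (simp_all add: complex_eq_iff)
qed

lemma quaternion_coefficients_unique:
  fixes x y z x' y' z' :: real
  assumes eq: "\<And>a. (2 * \<i> * of_real x) *s I a + (2 * \<i> * of_real y) *s J a + (2 * \<i> * of_real z) *s K a =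
      (2 * \<i> * of_real x') *s I a + (2 * \<i> * of_real y') *s J a + (2 * \<i> * of_real z') *s K a"
  shows "x = x'" "y = y'" "z = z'"
proof -
  have "of_real (x - x') *s I a + of_real (y - y') *s J a + of_real (z - z') *s K a = 0" for a
  proof -
    have "(of_real (x - x') *s I a + of_real (y - y') *s J a + of_real (z - z') *s K a) $ k = 0" for k
    proof -
      have "2 * \<i> * (of_real (x - x') *s I a + of_real (y - y') *s J a + of_real (z - z') *s K a) $ k = 0"
        using arg_cong[OF eq[of a], of "\<lambda>v. v $ k"] by (simp add: algebra_simps)
      then show ?thesis by simp
    qed
    then show ?thesis by (simp add: vec_eq_iff)
  qed
  from quaternion_independent[OF this] show "x = x'" "y = y'" "z = z'" by simp_all
qed

text \<open>The Fierz identity: on the tensor square of the spinor space the operator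
  \<open>1 - I \<otimes> I - J \<otimes> J - K \<otimes> K\<close> is twice the exchange of the factors.  By bilinearity it is verified on the basis
  \<open>u\<close>, \<open>v\<close>.\<close>

lemma fierz:
  assumes l: "\<And>a b. l (a + b) = l a + l b" "\<And>z a. l (z *s a) = z * l a"
  shows "l a *s c - l (I a) *s I c - l (J a) *s J c - l (K a) *s K c = (2 * l c) *s a"
proof -
  obtain u v where uv: "u \<noteq> 0" "I u = \<i> *s u" "J u = v" "K u = - \<i> *s v"
    "I v = - \<i> *s v" "J v = - u" "K v = - \<i> *s u" and "\<And>a. \<exists>s t. a = s *s u + t *s v"
    by (rule quaternion_basis) blast
  then obtain s t s' t' where a: "a = s *s u + t *s v" and c: "c = s' *s u + t' *s v" by metis
  have lm: "l (- x) = - l x" for x using l(2)[of "-1" x] by (simp add: vector_sneg_minus1[symmetric])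
  show ?thesis unfolding a c IJK_add IJK_scale uv(2-) l lm
    by (simp add: vec_eq_iff algebra_simps)
qed

text \<open>The symmetric bilinear form of which twice the squaring map is the restriction to the diagonal: \<open>tau \<phi> \<phi> i j / 2\<close> is
  the component of \<open>\<sigma>(\<phi>)\<close> on \<open>e i, e j\<close>, and \<open>tau \<phi> (\<nabla>\<phi>) i j\<close> is that of its covariant derivative.\<close>

definition tau :: "complex ^ 2 \<Rightarrow> complex ^ 2 \<Rightarrow> 4 \<Rightarrow> 4 \<Rightarrow> real" where
  "tau \<phi> \<psi> i j = - Im (H (M i (P j \<psi>)) \<phi> + H (M i (P j \<phi>)) \<psi>) / 4"

lemma H_minus: "H (- x) y = - H x y" using H_scale[of "-1" x y] by (simp add: vector_sneg_minus1[symmetric])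

lemma tau_anti: "tau \<phi> \<psi> i j = - tau \<phi> \<psi> j i"
proof (cases "i = j")
  case True
  have "Im (H \<psi> \<phi> + H \<phi> \<psi>) = 0" using H_herm[of \<psi> \<phi>] by simp
  then show ?thesis using True by (simp add: tau_def MP_self H_minus)
next
  case False
  then show ?thesis by (simp add: tau_def MP_anti[OF False] H_minus field_simps)
qed

lemma tau_self_dual: "tau \<phi> \<psi> 3 4 = tau \<phi> \<psi> 1 2" "tau \<phi> \<psi> 4 2 = tau \<phi> \<psi> 1 3" "tau \<phi> \<psi> 2 3 = tau \<phi> \<psi> 1 4"
  by (simp_all add: tau_def MP_34 MP_42 MP_23)

lemma tau_coefficient:
  assumes "i \<noteq> j"
  shows "H (M i (P j \<psi>)) \<phi> + H (M i (P j \<phi>)) \<psi> = - 4 * \<i> * of_real (tau \<phi> \<psi> i j)"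
proof -
  have "H (M i (P j \<phi>)) \<psi> = H \<phi> (- M i (P j \<psi>))"
    using MP_anti[OF assms, of \<psi>] by (simp add: H_adjoint)
  also have "\<dots> = cnj (H (- M i (P j \<psi>)) \<phi>)" by (rule H_herm)
  also have "H (- M i (P j \<psi>)) \<phi> = - H (M i (P j \<psi>)) \<phi>"
    by (rule H_minus)
  finally show ?thesis by (simp add: tau_def complex_eq_iff)
qed

text \<open>The defining equation of the squaring map, polarised: the sum of two instances of the Fierz identity.  The products
  of two different frame vectors are skew-Hermitian, hence the coefficients are imaginary.\<close>

lemma polarised_squaring:
  "(2 * \<i> * of_real (tau \<phi> \<psi> 1 2)) *s I c + (2 * \<i> * of_real (tau \<phi> \<psi> 1 3)) *s J c
     + (2 * \<i> * of_real (tau \<phi> \<psi> 1 4)) *s K c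
   = H c \<phi> *s \<psi> + H c \<psi> *s \<phi> - of_real (Re (H \<psi> \<phi>)) *s c"
proof -
  have re: "H \<psi> \<phi> + H \<phi> \<psi> = 2 * of_real (Re (H \<psi> \<phi>))"
    using H_herm[of \<phi> \<psi>] by (simp add: complex_eq_iff)
  define A B C where "A = H (I \<psi>) \<phi>" "B = H (J \<psi>) \<phi>" "C = H (K \<psi>) \<phi>"
  have A: "H (I \<phi>) \<psi> = - 4 * \<i> * of_real (tau \<phi> \<psi> 1 2) - A"
    and B: "H (J \<phi>) \<psi> = - 4 * \<i> * of_real (tau \<phi> \<psi> 1 3) - B"
    and C: "H (K \<phi>) \<psi> = - 4 * \<i> * of_real (tau \<phi> \<psi> 1 4) - C"
    using tau_coefficient[of 1 2 \<psi> \<phi>] tau_coefficient[of 1 3 \<psi> \<phi>] tau_coefficient[of 1 4 \<psi> \<phi>]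
    by (simp_all add: A_B_C_def algebra_simps)
  have D: "H \<phi> \<psi> = 2 * of_real (Re (H \<psi> \<phi>)) - H \<psi> \<phi>" using re by (simp add: algebra_simps)
  have f1: "H \<psi> \<phi> *s c - A *s I c - B *s J c - C *s K c = (2 * H c \<phi>) *s \<psi>"
    unfolding A_B_C_def by (rule fierz) (simp_all add: H_add H_scale)
  have f2: "H \<phi> \<psi> *s c - H (I \<phi>) \<psi> *s I c - H (J \<phi>) \<psi> *s J c - H (K \<phi>) \<psi> *s K c = (2 * H c \<psi>) *s \<phi>"
    by (rule fierz) (simp_all add: H_add H_scale)
  define x y z where "x = (of_real (tau \<phi> \<psi> 1 2) :: complex)" "y = (of_real (tau \<phi> \<psi> 1 3) :: complex)"
    "z = (of_real (tau \<phi> \<psi> 1 4) :: complex)"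
  have "((2 * \<i> * x) *s I c + (2 * \<i> * y) *s J c + (2 * \<i> * z) *s K c) $ k
    = (H c \<phi> *s \<psi> + H c \<psi> *s \<phi> - of_real (Re (H \<psi> \<phi>)) *s c) $ k" for k
    using arg_cong[OF f1, of "\<lambda>v. v $ k"] arg_cong[OF f2, of "\<lambda>v. v $ k"]
    unfolding A B C D x_y_z_def[symmetric] by simp algebra
  then show ?thesis unfolding vec_eq_iff x_y_z_def by blast
qed

text \<open>The theorem at a point, with \<open>\<psi> k\<close> for the derivative of \<open>\<phi>\<close> along \<open>e k\<close> and \<open>b\<close> for the exterior derivative of
  \<open>\<sigma>(\<phi>)\<close>.  The polarised squaring equation, applied to \<open>\<phi>\<close> itself, expresses \<open>\<bar>\<phi>\<bar>\<^sup>2 \<psi> k\<close> by the action of the derivative of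
  \<open>\<sigma>(\<phi>)\<close> and by a multiple of \<open>\<phi>\<close>, whose factor is the difference of the number \<open>H \<phi> (\<psi> k)\<close> and its real part.
  After multiplication by \<open>e k\<close>, products of three frame vectors reduce to single ones by self-duality.\<close>

lemma pointwise_identity:
  fixes \<phi> :: "complex ^ 2" and \<psi> :: "4 \<Rightarrow> complex ^ 2"
  defines "t \<equiv> \<lambda>k. tau \<phi> (\<psi> k)"
  defines "b \<equiv> \<lambda>i j k. t i j k - t j i k + t k i j"
  shows "H \<phi> \<phi> *s (P 1 (\<psi> 1) + P 2 (\<psi> 2) + P 3 (\<psi> 3) + P 4 (\<psi> 4)) =
    \<i> *s (of_real (2 * b 2 3 4 + Im (H (\<psi> 1) \<phi>)) *s P 1 \<phi> + of_real (- 2 * b 1 3 4 + Im (H (\<psi> 2) \<phi>)) *s P 2 \<phi> +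
           of_real (2 * b 1 2 4 + Im (H (\<psi> 3) \<phi>)) *s P 3 \<phi> + of_real (- 2 * b 1 2 3 + Im (H (\<psi> 4) \<phi>)) *s P 4 \<phi>)"
proof -
  have sq: "H \<phi> \<phi> *s P k (\<psi> k) =
      (2 * \<i> * of_real (t k 1 2)) *s P k (I \<phi>) + (2 * \<i> * of_real (t k 1 3)) *s P k (J \<phi>)
      + (2 * \<i> * of_real (t k 1 4)) *s P k (K \<phi>) + (\<i> * of_real (Im (H (\<psi> k) \<phi>))) *s P k \<phi>" for k
  proof -
    have "of_real (Re (H (\<psi> k) \<phi>)) - H \<phi> (\<psi> k) = \<i> * of_real (Im (H (\<psi> k) \<phi>))"
      using H_herm[of \<phi> "\<psi> k"] by (simp add: complex_eq_iff)
    then have "H \<phi> \<phi> *s \<psi> k = (H \<phi> \<phi> *s \<psi> k + H \<phi> (\<psi> k) *s \<phi> - of_real (Re (H (\<psi> k) \<phi>)) *s \<phi>)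
        + (\<i> * of_real (Im (H (\<psi> k) \<phi>))) *s \<phi>"
      by (simp add: vec_eq_iff algebra_simps flip: distrib_right) 
    also have "H \<phi> \<phi> *s \<psi> k + H \<phi> (\<psi> k) *s \<phi> - of_real (Re (H (\<psi> k) \<phi>)) *s \<phi>
      = (2 * \<i> * of_real (t k 1 2)) *s I \<phi> + (2 * \<i> * of_real (t k 1 3)) *s J \<phi>
      + (2 * \<i> * of_real (t k 1 4)) *s K \<phi>"
      unfolding t_def by (rule polarised_squaring[symmetric])
    finally show ?thesis by (simp only: P_add P_scale flip: P_scale)
  qed
  have pm: "P k (M l c) = - P l (M k c)" if "k \<noteq> l" for k l c using that by (rule PM_anti)
  have P1: "P 1 (I c) = - P 2 c" "P 1 (J c) = - P 3 c" "P 1 (K c) = - P 4 c" for c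
    by (simp_all add: PM_self)
  have P2: "P 2 (I c) = P 1 c" "P 2 (J c) = P 4 c" "P 2 (K c) = - P 3 c" for c
    by (simp_all only: MP_42[symmetric] MP_23[symmetric]) (simp_all add: pm[of 2 1] pm[of 2 4] MP_self PM_self P_minus)
  have P3: "P 3 (I c) = - P 4 c" "P 3 (J c) = P 1 c" "P 3 (K c) = P 2 c" for c
    by (simp_all only: MP_34[symmetric] MP_23[symmetric]) (simp_all add: pm[of 3 1] pm[of 3 2] MP_self PM_self P_minus)
  have P4: "P 4 (I c) = P 3 c" "P 4 (J c) = - P 2 c" "P 4 (K c) = P 1 c" for c
    by (simp_all only: MP_34[symmetric] MP_42[symmetric]) (simp_all add: pm[of 4 1] pm[of 4 3] MP_self PM_self P_minus)
  have sd: "t k 3 4 = t k 1 2" "t k 4 2 = t k 1 3" "t k 2 4 = - t k 1 3" "t k 2 3 = t k 1 4" for k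
    using tau_anti[of \<phi> "\<psi> k" 2 4] by (simp_all add: t_def tau_self_dual)
  show ?thesis
    unfolding vector_add_ldistrib sq P1 P2 P3 P4 b_def sd
    by (simp add: vec_eq_iff algebra_simps)
qed

end


section \<open>Fibres of vector bundles\<close>

text \<open>A chosen trivialisation at \<open>x\<close> identifies the fibre with \<open>'k ^ 'n\<close>.  It transports computations in a
  fibre, whose operations belong to the bundle, to a vector space type.\<close>

definition triv_at :: "('m, 'e, 'k, 'n::finite) vbundle \<Rightarrow> 'm \<Rightarrow> 'e \<Rightarrow> 'k ^ 'n" where
  "triv_at E x = snd (SOME t. t \<in> trivs E \<and> x \<in> fst t)"

definition untriv :: "('m, 'e, 'k, 'n::finite) vbundle \<Rightarrow> 'm \<Rightarrow> 'k ^ 'n \<Rightarrow> 'e" where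
  "untriv E x = inv_into (fibre E x) (triv_at E x)"

locale smooth_vector_bundle =
  fixes \<A> :: "'m::topological_space chart set"
    and E :: "('m, 'e, 'k::real_normed_field, 'n::finite) vbundle"
  assumes vb: "vector_bundle \<A> E"
begin

lemma triv_bij: "bij_betw (triv_at E x) (fibre E x) UNIV"
  and triv_add: "e \<in> fibre E x \<Longrightarrow> e' \<in> fibre E x \<Longrightarrow> triv_at E x (badd E e e') = triv_at E x e + triv_at E x e'"
  and triv_scale: "e \<in> fibre E x \<Longrightarrow> triv_at E x (bscl E c e) = c *s triv_at E x e"
proof -
  have "(\<Union>t\<in>trivs E. fst t) = UNIV" using vb unfolding vector_bundle_def by blast
  then have ex: "\<exists>t. t \<in> trivs E \<and> x \<in> fst t" by blast
  define t where "t = (SOME t. t \<in> trivs E \<and> x \<in> fst t)"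
  have t: "t \<in> trivs E" "x \<in> fst t" "triv_at E x = snd t"
    using someI_ex[OF ex] by (simp_all add: t_def triv_at_def)
  have *: "\<forall>t\<in>trivs E. open (fst t) \<and>
        (\<forall>x\<in>fst t. bij_betw (snd t) (fibre E x) UNIV \<and>
           (\<forall>e\<in>fibre E x. \<forall>e'\<in>fibre E x. snd t (badd E e e') = snd t e + snd t e') \<and>
           (\<forall>e\<in>fibre E x. \<forall>c. snd t (bscl E c e) = c *s snd t e))"
    using vb unfolding vector_bundle_def by (elim conjE)
  note ** = *[rule_format, OF t(1), THEN conjunct2, rule_format, OF t(2)]
  show "bij_betw (triv_at E x) (fibre E x) UNIV" unfolding t(3) using ** by blast
  show "e \<in> fibre E x \<Longrightarrow> e' \<in> fibre E x \<Longrightarrow> triv_at E x (badd E e e') = triv_at E x e + triv_at E x e'"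
    unfolding t(3) using ** by blast
  show "e \<in> fibre E x \<Longrightarrow> triv_at E x (bscl E c e) = c *s triv_at E x e"
    unfolding t(3) using ** by blast
qed

lemma add_fibre: "e \<in> fibre E x \<Longrightarrow> e' \<in> fibre E x \<Longrightarrow> badd E e e' \<in> fibre E x"
  and scale_fibre: "e \<in> fibre E x \<Longrightarrow> bscl E c e \<in> fibre E x"
  using vb[unfolded vector_bundle_def, THEN conjunct1] vb[unfolded vector_bundle_def, THEN conjunct2, THEN conjunct1]
  by blast+

lemma untriv_fibre: "untriv E x a \<in> fibre E x"
  and triv_untriv: "triv_at E x (untriv E x a) = a"
  and untriv_triv: "e \<in> fibre E x \<Longrightarrow> untriv E x (triv_at E x e) = e"
  using triv_bij[of x] unfolding untriv_def
  by (auto intro: inv_into_into f_inv_into_f inv_into_f_f simp: bij_betw_def)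

lemma fibre_eqI: "e \<in> fibre E x \<Longrightarrow> e' \<in> fibre E x \<Longrightarrow> triv_at E x e = triv_at E x e' \<Longrightarrow> e = e'"
  by (metis untriv_triv)

lemma untriv_add: "untriv E x (a + b) = badd E (untriv E x a) (untriv E x b)"
  by (rule fibre_eqI[of _ x], simp_all add: untriv_fibre add_fibre triv_add triv_untriv)

lemma untriv_scale: "untriv E x (c *s a) = bscl E c (untriv E x a)"
  by (rule fibre_eqI[of _ x], simp_all add: untriv_fibre add_fibre scale_fibre triv_add triv_scale triv_untriv)

lemma zero_of_eq: "zero_of E x = untriv E x 0"
  unfolding zero_of_def
proof (rule the_equality)
  show "untriv E x 0 \<in> fibre E x \<and> badd E (untriv E x 0) (untriv E x 0) = untriv E x 0"
    using untriv_add[of x 0 0] by (simp add: untriv_fibre)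
  fix z assume z: "z \<in> fibre E x \<and> badd E z z = z"
  then have "triv_at E x z = 0" using triv_add[of z x z] by simp
  then show "z = untriv E x 0" using z untriv_triv[of z x] by simp
qed

lemma fibre_sum:
  assumes "\<And>i. i \<in> set ks \<Longrightarrow> f i \<in> fibre E x"
  shows fibre_sum_fibre: "fibre_sum E x f ks \<in> fibre E x"
    and triv_fibre_sum: "triv_at E x (fibre_sum E x f ks) = (\<Sum>i\<leftarrow>ks. triv_at E x (f i))"
proof -
  have "fibre_sum E x f ks \<in> fibre E x \<and> triv_at E x (fibre_sum E x f ks) = (\<Sum>i\<leftarrow>ks. triv_at E x (f i))"
    using assms
    by (induction ks) (simp_all add: fibre_sum_def zero_of_eq untriv_fibre triv_untriv add_fibre triv_add)
  then show "fibre_sum E x f ks \<in> fibre E x" "triv_at E x (fibre_sum E x f ks) = (\<Sum>i\<leftarrow>ks. triv_at E x (f i))"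
    by simp_all
qed

end

section \<open>Spinors at a point and the squaring map\<close>

locale spinc_manifold = riemannian_manifold \<A> g
  for \<A> :: "'m::topological_space chart set" and g +
  fixes S :: "('m, 'p, 'q, 'l) spinc"
  assumes spinc: "spinc_structure \<A> g S"
begin

lemma hermitian_p: "hermitian_bundle \<A> (Wp S) (hp S)"
  and hermitian_m: "hermitian_bundle \<A> (Wm S) (hm S)"
  and clifford_p: "clifford_map \<A> (Wp S) (Wm S) (clp S)"
  and clifford_m: "clifford_map \<A> (Wm S) (Wp S) (clm S)"
  and clm_clp: "v \<in> tangent_space \<A> x \<Longrightarrow> a \<in> fibre (Wp S) x \<Longrightarrow>
      clm S v (clp S v a) = bscl (Wp S) (- of_real (g v v)) a"
  and clp_clm: "v \<in> tangent_space \<A> x \<Longrightarrow> b \<in> fibre (Wm S) x \<Longrightarrow>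
      clp S v (clm S v b) = bscl (Wm S) (- of_real (g v v)) b"
  and clp_skew: "v \<in> tangent_space \<A> x \<Longrightarrow> a \<in> fibre (Wp S) x \<Longrightarrow> b \<in> fibre (Wm S) x \<Longrightarrow>
      hm S (clp S v a) b = - hp S a (clm S v b)"
  and clifford_volume: "oriented_frame \<A> g x e \<Longrightarrow> a \<in> fibre (Wp S) x \<Longrightarrow>
      clm S (e 1) (clp S (e 2) (clm S (e 3) (clp S (e 4) a))) = bscl (Wp S) (-1) a"
  using spinc unfolding spinc_structure_def by (elim conjE; blast)+

sublocale Wp: smooth_vector_bundle \<A> "Wp S"
  using hermitian_p by unfold_locales (simp add: hermitian_bundle_def)

sublocale Wm: smooth_vector_bundle \<A> "Wm S"
  using hermitian_m by unfold_locales (simp add: hermitian_bundle_def)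

lemma hp_add: "a \<in> fibre (Wp S) x \<Longrightarrow> b \<in> fibre (Wp S) x \<Longrightarrow> c \<in> fibre (Wp S) x \<Longrightarrow>
      hp S (badd (Wp S) a b) c = hp S a c + hp S b c"
  and hp_scale: "a \<in> fibre (Wp S) x \<Longrightarrow> b \<in> fibre (Wp S) x \<Longrightarrow> hp S (bscl (Wp S) z a) b = z * hp S a b"
  and hp_herm: "a \<in> fibre (Wp S) x \<Longrightarrow> b \<in> fibre (Wp S) x \<Longrightarrow> hp S a b = cnj (hp S b a)"
  using hermitian_p[unfolded hermitian_bundle_def, THEN conjunct2, THEN conjunct1] by blast+

lemma hm_herm: "a \<in> fibre (Wm S) x \<Longrightarrow> b \<in> fibre (Wm S) x \<Longrightarrow> hm S a b = cnj (hm S b a)"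
  using hermitian_m[unfolded hermitian_bundle_def, THEN conjunct2, THEN conjunct1] by blast

lemma clp_fibre: "v \<in> tangent_space \<A> x \<Longrightarrow> a \<in> fibre (Wp S) x \<Longrightarrow> clp S v a \<in> fibre (Wm S) x"
  and clp_vec_add: "v \<in> tangent_space \<A> x \<Longrightarrow> w \<in> tangent_space \<A> x \<Longrightarrow> a \<in> fibre (Wp S) x \<Longrightarrow>
      clp S (badd T v w) a = badd (Wm S) (clp S v a) (clp S w a)"
  and clp_add: "v \<in> tangent_space \<A> x \<Longrightarrow> a \<in> fibre (Wp S) x \<Longrightarrow> b \<in> fibre (Wp S) x \<Longrightarrow>
      clp S v (badd (Wp S) a b) = badd (Wm S) (clp S v a) (clp S v b)"
  and clp_scale: "v \<in> tangent_space \<A> x \<Longrightarrow> a \<in> fibre (Wp S) x \<Longrightarrow>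
      clp S v (bscl (Wp S) z a) = bscl (Wm S) z (clp S v a)"
  using clifford_p[unfolded clifford_map_def Let_def, THEN conjunct1] by blast+

lemma clm_fibre: "v \<in> tangent_space \<A> x \<Longrightarrow> a \<in> fibre (Wm S) x \<Longrightarrow> clm S v a \<in> fibre (Wp S) x"
  and clm_vec_add: "v \<in> tangent_space \<A> x \<Longrightarrow> w \<in> tangent_space \<A> x \<Longrightarrow> a \<in> fibre (Wm S) x \<Longrightarrow>
      clm S (badd T v w) a = badd (Wp S) (clm S v a) (clm S w a)"
  and clm_vec_scale: "v \<in> tangent_space \<A> x \<Longrightarrow> a \<in> fibre (Wm S) x \<Longrightarrow>
      clm S (bscl T r v) a = bscl (Wp S) (of_real r) (clm S v a)"
  and clm_add: "v \<in> tangent_space \<A> x \<Longrightarrow> a \<in> fibre (Wm S) x \<Longrightarrow> b \<in> fibre (Wm S) x \<Longrightarrow>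
      clm S v (badd (Wm S) a b) = badd (Wp S) (clm S v a) (clm S v b)"
  and clm_scale: "v \<in> tangent_space \<A> x \<Longrightarrow> a \<in> fibre (Wm S) x \<Longrightarrow>
      clm S v (bscl (Wm S) z a) = bscl (Wp S) z (clm S v a)"
  using clifford_m[unfolded clifford_map_def Let_def, THEN conjunct1] by blast+

text \<open>Clifford multiplication and the Hermitian metric at a point, in the coordinates given by the chosen
  trivialisations.\<close>

definition cp :: "'m \<Rightarrow> 'm tangent \<Rightarrow> complex ^ 2 \<Rightarrow> complex ^ 2" where
  "cp x v a = triv_at (Wm S) x (clp S v (untriv (Wp S) x a))"

definition cm :: "'m \<Rightarrow> 'm tangent \<Rightarrow> complex ^ 2 \<Rightarrow> complex ^ 2" where
  "cm x v b = triv_at (Wp S) x (clm S v (untriv (Wm S) x b))"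

definition hc :: "'m \<Rightarrow> complex ^ 2 \<Rightarrow> complex ^ 2 \<Rightarrow> complex" where
  "hc x a b = hp S (untriv (Wp S) x a) (untriv (Wp S) x b)"

lemma triv_clp: "v \<in> tangent_space \<A> x \<Longrightarrow> a \<in> fibre (Wp S) x \<Longrightarrow>
    triv_at (Wm S) x (clp S v a) = cp x v (triv_at (Wp S) x a)"
  and triv_clm: "v \<in> tangent_space \<A> x \<Longrightarrow> b \<in> fibre (Wm S) x \<Longrightarrow>
    triv_at (Wp S) x (clm S v b) = cm x v (triv_at (Wm S) x b)"
  and hp_hc: "a \<in> fibre (Wp S) x \<Longrightarrow> a' \<in> fibre (Wp S) x \<Longrightarrow>
    hp S a a' = hc x (triv_at (Wp S) x a) (triv_at (Wp S) x a')"
  by (simp_all add: cp_def cm_def hc_def Wp.untriv_triv Wm.untriv_triv)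

lemma cp_vec_add: "v \<in> tangent_space \<A> x \<Longrightarrow> w \<in> tangent_space \<A> x \<Longrightarrow> cp x (badd T v w) a = cp x v a + cp x w a"
  and cm_vec_add: "v \<in> tangent_space \<A> x \<Longrightarrow> w \<in> tangent_space \<A> x \<Longrightarrow> cm x (badd T v w) b = cm x v b + cm x w b"
  and cm_vec_scale: "v \<in> tangent_space \<A> x \<Longrightarrow> cm x (bscl T r v) b = of_real r *s cm x v b"
  and cp_add: "v \<in> tangent_space \<A> x \<Longrightarrow> cp x v (a + a') = cp x v a + cp x v a'"
  and cm_add: "v \<in> tangent_space \<A> x \<Longrightarrow> cm x v (b + b') = cm x v b + cm x v b'"
  and cp_scale: "v \<in> tangent_space \<A> x \<Longrightarrow> cp x v (z *s a) = z *s cp x v a"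
  and cm_scale: "v \<in> tangent_space \<A> x \<Longrightarrow> cm x v (z *s b) = z *s cm x v b"
  unfolding cp_def cm_def Wp.untriv_add Wm.untriv_add Wp.untriv_scale Wm.untriv_scale
  by (simp_all add: clp_vec_add[where x = x] clm_vec_add[where x = x] clm_vec_scale[where x = x]
      clp_add[where x = x] clm_add[where x = x] clp_scale[where x = x] clm_scale[where x = x]
      Wp.untriv_fibre Wm.untriv_fibre clp_fibre clm_fibre
      Wp.triv_add Wm.triv_add Wp.triv_scale Wm.triv_scale)

lemma cm_cp_self: "v \<in> tangent_space \<A> x \<Longrightarrow> cm x v (cp x v a) = - of_real (g v v) *s a"
  and cp_cm_self: "v \<in> tangent_space \<A> x \<Longrightarrow> cp x v (cm x v b) = - of_real (g v v) *s b"
  by (simp_all add: cp_def cm_def Wp.untriv_triv Wm.untriv_triv clp_fibre clm_fibre Wp.untriv_fibre Wm.untriv_fibre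
     clm_clp[where x = x] clp_clm[where x = x] Wp.triv_scale Wm.triv_scale Wp.triv_untriv Wm.triv_untriv)

lemma g_square:
  assumes v: "v \<in> tangent_space \<A> x" and w: "w \<in> tangent_space \<A> x"
  shows "g (badd T v w) (badd T v w) = g v v + 2 * g v w + g w w"
  using g_sym[OF v w] by (simp only: g_add[OF v w tangent_add[OF v w]] g_add_right[OF v w v] g_add_right[OF v w w])

text \<open>Polarisation of \<open>v \<bullet> v \<bullet> a = - g v v a\<close>.\<close>

lemma clifford_relation:
  assumes v: "v \<in> tangent_space \<A> x" and w: "w \<in> tangent_space \<A> x"
  shows "cm x v (cp x w a) + cm x w (cp x v a) = - (2 * of_real (g v w)) *s a"
    and "cp x v (cm x w b) + cp x w (cm x v b) = - (2 * of_real (g v w)) *s b"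
proof -
  note vw = tangent_add[OF v w]
  show "cm x v (cp x w a) + cm x w (cp x v a) = - (2 * of_real (g v w)) *s a"
    using cm_cp_self[OF vw, of a] cm_cp_self[OF v, of a] cm_cp_self[OF w, of a]
    unfolding g_square[OF v w] cp_vec_add[OF v w] cm_vec_add[OF v w] cm_add[OF v] cm_add[OF w]
    by (simp add: vec_eq_iff algebra_simps) (simp add: eq_neg_iff_add_eq_0 add.assoc)
  show "cp x v (cm x w b) + cp x w (cm x v b) = - (2 * of_real (g v w)) *s b"
    using cp_cm_self[OF vw, of b] cp_cm_self[OF v, of b] cp_cm_self[OF w, of b]
    unfolding g_square[OF v w] cp_vec_add[OF v w] cm_vec_add[OF v w] cp_add[OF v] cp_add[OF w]
    by (simp add: vec_eq_iff algebra_simps) (simp add: eq_neg_iff_add_eq_0 add.assoc)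
qed

lemma hc_adjoint:
  assumes v: "v \<in> tangent_space \<A> x" and w: "w \<in> tangent_space \<A> x"
  shows "hc x (cm x v (cp x w a)) b = hc x a (cm x w (cp x v b))"
proof -
  let ?a = "untriv (Wp S) x a" and ?b = "untriv (Wp S) x b"
  have a: "?a \<in> fibre (Wp S) x" and b: "?b \<in> fibre (Wp S) x" by (simp_all add: Wp.untriv_fibre)
  note wa = clp_fibre[OF w a] and vb = clp_fibre[OF v b]
  have "hp S (clm S v (clp S w ?a)) ?b = cnj (hp S ?b (clm S v (clp S w ?a)))"
    by (rule hp_herm[OF clm_fibre[OF v wa] b])
  also have "\<dots> = - cnj (hm S (clp S v ?b) (clp S w ?a))" by (simp add: clp_skew[OF v b wa])
  also have "\<dots> = - hm S (clp S w ?a) (clp S v ?b)" using hm_herm[OF wa vb] by simp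
  also have "\<dots> = hp S ?a (clm S w (clp S v ?b))" by (simp add: clp_skew[OF w a vb])
  finally show ?thesis
    by (simp add: hc_def cm_def cp_def Wm.untriv_triv[OF wa] Wm.untriv_triv[OF vb]
       Wp.untriv_triv[OF clm_fibre[OF v wa]] Wp.untriv_triv[OF clm_fibre[OF w vb]])
qed

lemma hc_add: "hc x (a + a') b = hc x a b + hc x a' b"
  and hc_scale: "hc x (z *s a) b = z * hc x a b"
  and hc_herm: "hc x a b = cnj (hc x b a)"
  unfolding hc_def Wp.untriv_add Wp.untriv_scale
  by (rule hp_add[OF Wp.untriv_fibre Wp.untriv_fibre Wp.untriv_fibre] hp_scale[OF Wp.untriv_fibre Wp.untriv_fibre]
      hp_herm[OF Wp.untriv_fibre Wp.untriv_fibre])+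

sublocale pt: clifford_frame "\<lambda>i. cp x (frame_at \<A> g x i)" "\<lambda>i. cm x (frame_at \<A> g x i)" "hc x" for x
proof
  note e = frame_tangent[of x]
  fix i j a a' b b' z
  show "cp x (frame_at \<A> g x i) (a + a') = cp x (frame_at \<A> g x i) a + cp x (frame_at \<A> g x i) a'" by (rule cp_add[OF e])
  show "cm x (frame_at \<A> g x i) (b + b') = cm x (frame_at \<A> g x i) b + cm x (frame_at \<A> g x i) b'" by (rule cm_add[OF e])
  show "cp x (frame_at \<A> g x i) (z *s a) = z *s cp x (frame_at \<A> g x i) a" by (rule cp_scale[OF e])
  show "cm x (frame_at \<A> g x i) (z *s b) = z *s cm x (frame_at \<A> g x i) b" by (rule cm_scale[OF e])
  show "cm x (frame_at \<A> g x i) (cp x (frame_at \<A> g x i) a) = - a"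
    using cm_cp_self[OF e, of i a] by (simp add: frame_orthonormal vector_sneg_minus1[symmetric])
  show "cp x (frame_at \<A> g x i) (cm x (frame_at \<A> g x i) b) = - b"
    using cp_cm_self[OF e, of i b] by (simp add: frame_orthonormal vector_sneg_minus1[symmetric])
  show "i \<noteq> j \<Longrightarrow> cm x (frame_at \<A> g x i) (cp x (frame_at \<A> g x j) a) = - cm x (frame_at \<A> g x j) (cp x (frame_at \<A> g x i) a)"
    using clifford_relation(1)[OF e e, of i j a] by (simp add: frame_orthonormal add_eq_0_iff2)
  show "i \<noteq> j \<Longrightarrow> cp x (frame_at \<A> g x i) (cm x (frame_at \<A> g x j) b) = - cp x (frame_at \<A> g x j) (cm x (frame_at \<A> g x i) b)"
    using clifford_relation(2)[OF e e, of i j b] by (simp add: frame_orthonormal add_eq_0_iff2)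
  show "cm x (frame_at \<A> g x 1) (cp x (frame_at \<A> g x 2) (cm x (frame_at \<A> g x 3) (cp x (frame_at \<A> g x 4) a))) = - a"
    using clifford_volume[OF oriented_frame_at Wp.untriv_fibre, of x a]
    by (simp add: cp_def cm_def Wp.untriv_triv Wm.untriv_triv clp_fibre clm_fibre e Wp.untriv_fibre Wp.triv_scale Wp.triv_untriv
         vector_sneg_minus1[symmetric])
  show "hc x (a + a') b = hc x a b + hc x a' b" "hc x (z *s a) b = z * hc x a b" "hc x a b = cnj (hc x b a)"
    by (rule hc_add hc_scale hc_herm)+
  show "hc x (cm x (frame_at \<A> g x i) (cp x (frame_at \<A> g x j) a)) b = hc x a (cm x (frame_at \<A> g x j) (cp x (frame_at \<A> g x i) b))"
    by (rule hc_adjoint[OF e e])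
qed

text \<open>An explicit formula for the squaring map.  It shows the smoothness of \<open>\<sigma>(\<phi>)\<close> and makes it differentiable by the
  Leibniz rules.  The factor comes from taking traces: composed
  with \<open>e\<^sub>i e\<^sub>j\<close>, for \<open>i \<noteq> j\<close>, the action of \<open>i\<sigma>\<close> has the trace \<open>- 4 i \<sigma>\<^sub>i\<^sub>j\<close>, and the endomorphism by which \<open>\<sigma>(\<phi>)\<close> is defined
  has the trace \<open>\<langle>e\<^sub>i e\<^sub>j \<phi>, \<phi>\<rangle>\<close>.\<close>

definition sq :: "'p \<Rightarrow> 'm tangent \<Rightarrow> 'm tangent \<Rightarrow> real" where
  "sq \<phi> v w = - Im (hp S (clm S v (clp S w \<phi>)) \<phi>) / 4"

lemma sq_hc:
  assumes "\<phi> \<in> fibre (Wp S) x" "v \<in> tangent_space \<A> x" "w \<in> tangent_space \<A> x"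
  shows "sq \<phi> v w = - Im (hc x (cm x v (cp x w (triv_at (Wp S) x \<phi>))) (triv_at (Wp S) x \<phi>)) / 4"
  using assms by (simp add: sq_def hp_hc[where x = x] clm_fibre clp_fibre triv_clm triv_clp)

lemma sq_frame:
  assumes "\<phi> \<in> fibre (Wp S) x"
  shows "sq \<phi> (frame_at \<A> g x i) (frame_at \<A> g x j) = pt.tau x (triv_at (Wp S) x \<phi>) (triv_at (Wp S) x \<phi>) i j / 2"
  by (simp add: sq_hc[OF assms frame_tangent frame_tangent] pt.tau_def)

lemma sq_add_left:
  assumes "\<phi> \<in> fibre (Wp S) x" "u \<in> tangent_space \<A> x" "v \<in> tangent_space \<A> x" "w \<in> tangent_space \<A> x"
  shows "sq \<phi> (badd T u v) w = sq \<phi> u w + sq \<phi> v w"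
  using assms by (simp add: sq_hc[where x = x] tangent_add cm_vec_add hc_add add_divide_distrib)

lemma sq_scale_left:
  assumes "\<phi> \<in> fibre (Wp S) x" "v \<in> tangent_space \<A> x" "w \<in> tangent_space \<A> x"
  shows "sq \<phi> (bscl T c v) w = c * sq \<phi> v w"
  using assms by (simp add: sq_hc[where x = x] tangent_scale cm_vec_scale hc_scale)

lemma sq_anti:
  assumes \<phi>: "\<phi> \<in> fibre (Wp S) x" and v: "v \<in> tangent_space \<A> x" and w: "w \<in> tangent_space \<A> x"
  shows "sq \<phi> v w = - sq \<phi> w v"
proof -
  let ?a = "triv_at (Wp S) x \<phi>"
  have "Im (hc x ?a ?a) = 0" using hc_herm[of x ?a ?a] by (metis Reals_cnj_iff complex_is_Real_iff)
  then have "Im (hc x (cm x v (cp x w ?a) + cm x w (cp x v ?a)) ?a) = 0"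
    unfolding clifford_relation(1)[OF v w] hc_scale by simp
  then show ?thesis unfolding sq_hc[OF \<phi> v w] sq_hc[OF \<phi> w v] hc_add by simp
qed

lemma sq_self_dual:
  assumes \<phi>: "\<phi> \<in> fibre (Wp S) x"
  shows "(\<lambda>vs. if vs \<in> vectors_at \<A> 2 x then sq \<phi> (vs ! 0) (vs ! 1) else 0) \<in> self_dual_at \<A> g x"
  by (rule self_dual_from_components)
     (rule sq_add_left[OF \<phi>] sq_scale_left[OF \<phi>] sq_anti[OF \<phi>] | assumption
      | simp add: sq_frame[OF \<phi>] pt.tau_self_dual)+

text \<open>Self-duality folds the six summands of the action of a 2-form into three.\<close>

lemma triv_cl2:
  assumes \<psi>: "\<psi> \<in> fibre (Wp S) x" and \<alpha>: "\<alpha> \<in> self_dual_at \<A> g x"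
  defines "e \<equiv> frame_at \<A> g x" and "a \<equiv> triv_at (Wp S) x \<psi>"
  shows "cl2 \<A> g S \<alpha> \<psi> \<in> fibre (Wp S) x"
    and "triv_at (Wp S) x (cl2 \<A> g S \<alpha> \<psi>) =
      of_real (2 * \<alpha> [e 1, e 2]) *s cm x (e 1) (cp x (e 2) a) + of_real (2 * \<alpha> [e 1, e 3]) *s cm x (e 1) (cp x (e 3) a)
      + of_real (2 * \<alpha> [e 1, e 4]) *s cm x (e 1) (cp x (e 4) a)"
proof -
  have base: "bproj (Wp S) \<psi> = x" using \<psi> by (simp add: fibre_def)
  have e: "e i \<in> tangent_space \<A> x" for i unfolding e_def by (rule frame_tangent)
  have sd: "\<alpha> [e 3, e 4] = \<alpha> [e 1, e 2]" "\<alpha> [e 2, e 4] = - \<alpha> [e 1, e 3]" "\<alpha> [e 2, e 3] = \<alpha> [e 1, e 4]"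
    using self_dual_components[OF \<alpha>, folded e_def] alternating_2_anti[OF _ e e, of \<alpha> 2 4] \<alpha>
    by (simp_all add: self_dual_at_def)
  let ?f = "\<lambda>(i, j). bscl (Wp S) (of_real (\<alpha> [e i, e j])) (clm S (e i) (clp S (e j) \<psi>))"
  have cl2: "cl2 \<A> g S \<alpha> \<psi> = fibre_sum (Wp S) x ?f [(1, 2), (1, 3), (1, 4), (2, 3), (2, 4), (3, 4)]"
    by (simp add: cl2_def base Let_def e_def)
  have f: "?f ij \<in> fibre (Wp S) x" for ij
    by (cases ij) (simp add: Wp.scale_fibre clm_fibre[OF e] clp_fibre[OF e] \<psi>)
  have tf: "triv_at (Wp S) x (?f (i, j)) = of_real (\<alpha> [e i, e j]) *s cm x (e i) (cp x (e j) a)" for i j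
    by (simp add: Wp.triv_scale clm_fibre[OF e] clp_fibre[OF e] \<psi> triv_clm[OF e] triv_clp[OF e] a_def)
  show "cl2 \<A> g S \<alpha> \<psi> \<in> fibre (Wp S) x"
    unfolding cl2 by (rule Wp.fibre_sum_fibre) (rule f)
  have mp: "cm x (e 3) (cp x (e 4) a) = cm x (e 1) (cp x (e 2) a)" "cm x (e 2) (cp x (e 3) a) = cm x (e 1) (cp x (e 4) a)"
    "cm x (e 2) (cp x (e 4) a) = - cm x (e 1) (cp x (e 3) a)"
    using pt.MP_34[of x a] pt.MP_23[of x a] pt.MP_42[of x a] pt.MP_anti[of 2 4 x a] by (simp_all add: e_def)
  have "triv_at (Wp S) x (cl2 \<A> g S \<alpha> \<psi>) = (\<Sum>ij\<leftarrow>[(1, 2), (1, 3), (1, 4), (2, 3), (2, 4), (3, 4)]. triv_at (Wp S) x (?f ij))"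
    unfolding cl2 by (rule Wp.triv_fibre_sum) (rule f)
  then show "triv_at (Wp S) x (cl2 \<A> g S \<alpha> \<psi>) =
      of_real (2 * \<alpha> [e 1, e 2]) *s cm x (e 1) (cp x (e 2) a) + of_real (2 * \<alpha> [e 1, e 3]) *s cm x (e 1) (cp x (e 3) a)
      + of_real (2 * \<alpha> [e 1, e 4]) *s cm x (e 1) (cp x (e 4) a)"
    unfolding list.map tf mp sd by (simp add: vec_eq_iff algebra_simps)
qed

text \<open>The polarised squaring equation on the diagonal shows that the explicit form has the defining property, and the
  independence of \<open>I\<close>, \<open>J\<close>, \<open>K\<close> shows that no other self-dual form has it.\<close>

lemma squaring_eq:
  assumes \<phi>: "\<phi> \<in> fibre (Wp S) x"
  shows "squaring \<A> g S \<phi> = (\<lambda>vs. if vs \<in> vectors_at \<A> 2 x then sq \<phi> (vs ! 0) (vs ! 1) else 0)" (is "_ = ?\<alpha>")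
proof -
  let ?b = "triv_at (Wp S) x \<phi>" and ?e = "frame_at \<A> g x"
  have base: "bproj (Wp S) \<phi> = x" using \<phi> by (simp add: fibre_def)
  let ?R = "\<lambda>\<alpha> \<psi>. bscl (Wp S) \<i> (cl2 \<A> g S \<alpha> \<psi>) =
           badd (Wp S) (bscl (Wp S) (hp S \<psi> \<phi>) \<phi>) (bscl (Wp S) (- (hp S \<phi> \<phi> / 2)) \<psi>)"
  have R: "?R \<alpha> \<psi> \<longleftrightarrow>
      (2 * \<i> * of_real (\<alpha> [?e 1, ?e 2])) *s pt.I x a + (2 * \<i> * of_real (\<alpha> [?e 1, ?e 3])) *s pt.J x a
        + (2 * \<i> * of_real (\<alpha> [?e 1, ?e 4])) *s pt.K x a
      = hc x a ?b *s ?b - (hc x ?b ?b / 2) *s a"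
    if \<alpha>: "\<alpha> \<in> self_dual_at \<A> g x" and \<psi>: "\<psi> \<in> fibre (Wp S) x" and a: "a = triv_at (Wp S) x \<psi>" for \<alpha> \<psi> a
  proof -
    have "bscl (Wp S) \<i> (cl2 \<A> g S \<alpha> \<psi>) \<in> fibre (Wp S) x"
      "badd (Wp S) (bscl (Wp S) (hp S \<psi> \<phi>) \<phi>) (bscl (Wp S) (- (hp S \<phi> \<phi> / 2)) \<psi>) \<in> fibre (Wp S) x"
      using \<phi> \<psi> triv_cl2(1)[OF \<psi> \<alpha>] by (simp_all add: Wp.scale_fibre Wp.add_fibre)
    then have "?R \<alpha> \<psi> \<longleftrightarrow> triv_at (Wp S) x (bscl (Wp S) \<i> (cl2 \<A> g S \<alpha> \<psi>)) =
       triv_at (Wp S) x (badd (Wp S) (bscl (Wp S) (hp S \<psi> \<phi>) \<phi>) (bscl (Wp S) (- (hp S \<phi> \<phi> / 2)) \<psi>))"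
      by (metis Wp.untriv_triv)
    then show ?thesis
      using \<phi> \<psi> triv_cl2(1)[OF \<psi> \<alpha>]
      by (simp add: Wp.scale_fibre Wp.add_fibre Wp.triv_scale Wp.triv_add triv_cl2(2)[OF \<psi> \<alpha>] hp_hc[where x = x] flip: a)
         (simp add: vec_eq_iff algebra_simps)
  qed
  show ?thesis
    unfolding squaring_def base
  proof (rule the_equality)
    have square: "?R ?\<alpha> \<psi>" if \<psi>: "\<psi> \<in> fibre (Wp S) x" for \<psi>
    proof -
      let ?a = "triv_at (Wp S) x \<psi>"
      have c: "?\<alpha> [?e i, ?e j] = pt.tau x ?b ?b i j / 2" for i j
        using frame_tangent[of x i] frame_tangent[of x j] by (simp add: vectors_at_2 sq_frame[OF \<phi>])
      have re: "of_real (Re (hc x ?b ?b)) = hc x ?b ?b"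
        using hc_herm[of x ?b ?b] by (metis Reals_cnj_iff of_real_Re)
      have "(\<i> * of_real (pt.tau x ?b ?b 1 2)) *s pt.I x ?a + (\<i> * of_real (pt.tau x ?b ?b 1 3)) *s pt.J x ?a
          + (\<i> * of_real (pt.tau x ?b ?b 1 4)) *s pt.K x ?a = hc x ?a ?b *s ?b - (hc x ?b ?b / 2) *s ?a"
        using pt.polarised_squaring[of x ?b ?b ?a] unfolding re vec_eq_iff by (simp add: field_simps)
      then show ?thesis unfolding R[OF sq_self_dual[OF \<phi>] \<psi> refl] c by simp
    qed
    then show "?\<alpha> \<in> self_dual_at \<A> g x \<and> (\<forall>\<psi>\<in>fibre (Wp S) x. ?R ?\<alpha> \<psi>)"
      using sq_self_dual[OF \<phi>] by blast
    fix \<beta> assume \<beta>: "\<beta> \<in> self_dual_at \<A> g x \<and> (\<forall>\<psi>\<in>fibre (Wp S) x. ?R \<beta> \<psi>)"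
    have "(2 * \<i> * of_real (\<beta> [?e 1, ?e 2])) *s pt.I x a + (2 * \<i> * of_real (\<beta> [?e 1, ?e 3])) *s pt.J x a
        + (2 * \<i> * of_real (\<beta> [?e 1, ?e 4])) *s pt.K x a =
      (2 * \<i> * of_real (?\<alpha> [?e 1, ?e 2])) *s pt.I x a + (2 * \<i> * of_real (?\<alpha> [?e 1, ?e 3])) *s pt.J x a
        + (2 * \<i> * of_real (?\<alpha> [?e 1, ?e 4])) *s pt.K x a" for a
    proof -
      let ?\<psi> = "untriv (Wp S) x a"
      have \<psi>: "?\<psi> \<in> fibre (Wp S) x" "a = triv_at (Wp S) x ?\<psi>" by (simp_all add: Wp.untriv_fibre Wp.triv_untriv)
      have "?R \<beta> ?\<psi>" "?R ?\<alpha> ?\<psi>" using \<beta> \<psi> square by blast+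
      then show ?thesis
        unfolding R[OF conjunct1[OF \<beta>] \<psi>] R[OF sq_self_dual[OF \<phi>] \<psi>] by (rule trans[OF _ sym])
    qed
    note unique = pt.quaternion_coefficients_unique[OF this]
    show "\<beta> = ?\<alpha>"
      by (rule self_dual_eqI[OF conjunct1[OF \<beta>] sq_self_dual[OF \<phi>] unique])
  qed
qed

end


section \<open>The exterior derivative of the square of a spinor field\<close>

lemma connection_fibre:
  assumes "connection \<A> E N" "open V" "smooth_section \<A> E V s" "p \<in> V" "v \<in> tangent_space \<A> p"
  shows "N v s \<in> fibre E p"
  using assms(1)[unfolded connection_def Let_def, THEN spec[of _ V], THEN spec[of _ s], THEN mp,
      OF conjI[OF assms(2,3)], THEN conjunct1] assms(4,5) by blast

locale spinor_field = spinc_manifold \<A> g S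
  for \<A> :: "'m::topological_space chart set" and g and S :: "('m, 'p, 'q, 'l) spinc" +
  fixes N :: "'m tangent \<Rightarrow> ('m \<Rightarrow> 'm tangent) \<Rightarrow> 'm tangent"
    and A :: "'m tangent \<Rightarrow> ('m \<Rightarrow> 'l) \<Rightarrow> 'l"
    and Np :: "'m tangent \<Rightarrow> ('m \<Rightarrow> 'p) \<Rightarrow> 'p"
    and Nm :: "'m tangent \<Rightarrow> ('m \<Rightarrow> 'q) \<Rightarrow> 'q"
    and \<phi> :: "'m \<Rightarrow> 'p"
  assumes levi_civita: "levi_civita \<A> g N"
    and spinc_connection: "spinc_connection \<A> g S N A Np Nm"
    and \<phi>_smooth: "smooth_section \<A> (Wp S) UNIV \<phi>"
begin

lemma clp_smooth:
  assumes "open V" "smooth_section \<A> T V X" "smooth_section \<A> (Wp S) V s"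
  shows "smooth_section \<A> (Wm S) V (\<lambda>x. clp S (X x) (s x))"
  using clifford_p[unfolded clifford_map_def Let_def, THEN conjunct2, THEN spec[of _ V], THEN spec[of _ X], THEN spec[of _ s]]
    assms by blast

lemma clm_smooth:
  assumes "open V" "smooth_section \<A> T V X" "smooth_section \<A> (Wm S) V s"
  shows "smooth_section \<A> (Wp S) V (\<lambda>x. clm S (X x) (s x))"
  using clifford_m[unfolded clifford_map_def Let_def, THEN conjunct2, THEN spec[of _ V], THEN spec[of _ X], THEN spec[of _ s]]
    assms by blast

lemma hp_smooth:
  assumes "open V" "smooth_section \<A> (Wp S) V s" "smooth_section \<A> (Wp S) V t"
  shows "smooth_map \<A> V (\<lambda>x. hp S (s x) (t x))"
  using hermitian_p[unfolded hermitian_bundle_def, THEN conjunct2, THEN conjunct2, THEN conjunct2,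
      THEN spec[of _ V], THEN spec[of _ s], THEN spec[of _ t]] assms by blast

lemma N_connection: "connection \<A> T N"
  by (rule levi_civita[unfolded levi_civita_def metric_connection_def, THEN conjunct1, THEN conjunct1])

lemma torsion_free:
  fixes f :: "'m \<Rightarrow> real"
  assumes "open V" "smooth_section \<A> T V X" "smooth_section \<A> T V Y" "smooth_map \<A> V f" "p \<in> V"
  shows "deriv_along \<A> (N (X p) Y) f - deriv_along \<A> (N (Y p) X) f =
      deriv_along \<A> (X p) (\<lambda>q. deriv_along \<A> (Y q) f) - deriv_along \<A> (Y p) (\<lambda>q. deriv_along \<A> (X q) f)"
  using levi_civita[unfolded levi_civita_def, THEN conjunct2, THEN spec[of _ V], THEN spec[of _ X],
      THEN spec[of _ Y], THEN spec[of _ f]] assms by blast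

lemma Np_metric: "metric_connection \<A> (Wp S) (hp S) Np"
  by (rule spinc_connection[unfolded spinc_connection_def, THEN conjunct1])

lemma Nm_leibniz:
  assumes "open V" "smooth_section \<A> T V X" "smooth_section \<A> (Wp S) V s" "p \<in> V" "v \<in> tangent_space \<A> p"
  shows "Nm v (\<lambda>x. clp S (X x) (s x)) = badd (Wm S) (clp S (N v X) (s p)) (clp S (X p) (Np v s))"
  using spinc_connection[unfolded spinc_connection_def, THEN conjunct2, THEN conjunct2, THEN conjunct1,
      THEN spec[of _ V], THEN spec[of _ X], THEN spec[of _ s]] assms by blast

lemma Np_leibniz:
  assumes "open V" "smooth_section \<A> T V X" "smooth_section \<A> (Wm S) V t" "p \<in> V" "v \<in> tangent_space \<A> p"
  shows "Np v (\<lambda>x. clm S (X x) (t x)) = badd (Wp S) (clm S (N v X) (t p)) (clm S (X p) (Nm v t))"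
  using spinc_connection[unfolded spinc_connection_def, THEN conjunct2, THEN conjunct2, THEN conjunct2, THEN conjunct1,
      THEN spec[of _ V], THEN spec[of _ X], THEN spec[of _ t]] assms by blast

lemma N_tangent:
  "open V \<Longrightarrow> smooth_section \<A> T V X \<Longrightarrow> p \<in> V \<Longrightarrow> v \<in> tangent_space \<A> p \<Longrightarrow> N v X \<in> tangent_space \<A> p"
  by (rule connection_fibre[OF N_connection])

lemma Np_fibre:
  "open V \<Longrightarrow> smooth_section \<A> (Wp S) V s \<Longrightarrow> p \<in> V \<Longrightarrow> v \<in> tangent_space \<A> p \<Longrightarrow> Np v s \<in> fibre (Wp S) p"
  by (rule connection_fibre[OF Np_metric[unfolded metric_connection_def, THEN conjunct1]])

lemma hp_deriv:
  assumes "open V" "smooth_section \<A> (Wp S) V s" "smooth_section \<A> (Wp S) V t" "p \<in> V" "v \<in> tangent_space \<A> p"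
  shows "deriv_along \<A> v (\<lambda>x. hp S (s x) (t x)) = hp S (Np v s) (t p) + hp S (s p) (Np v t)"
  using Np_metric[unfolded metric_connection_def, THEN conjunct2, THEN spec[of _ V], THEN spec[of _ s], THEN spec[of _ t]]
    assms by blast

lemma \<phi>_section: "smooth_section \<A> (Wp S) V \<phi>"
  using \<phi>_smooth by (rule smooth_section_subset) simp

lemma \<phi>_fibre: "\<phi> x \<in> fibre (Wp S) x"
  using \<phi>_smooth unfolding smooth_section_def by blast

abbreviation "ext p v \<equiv> const_field \<A> (chart_at \<A> p) v"
abbreviation "nbhd p \<equiv> fst (chart_at \<A> p)"

lemma nbhd: "open (nbhd p)" "p \<in> nbhd p" "smooth_section \<A> T (nbhd p) (ext p v)"
  by (rule chart_open[OF chart_at(1)] chart_at(2) const_field_smooth[OF chart_at(1)])+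

lemma ext_tangent: "q \<in> nbhd p \<Longrightarrow> ext p v q \<in> tangent_space \<A> q"
  by (rule const_field_tangent[OF chart_at(1)])

lemma ext_at: "v \<in> tangent_space \<A> p \<Longrightarrow> ext p v p = v"
  by (rule const_field_at[OF chart_at])

text \<open>Vector fields with constant components in a chart commute; so their mutual covariant derivatives agree, as the
  connection is free of torsion.  The coordinates of the chart have constant derivatives along such fields, hence
  the right-hand side of the torsion identity vanishes for them.\<close>

lemma N_symmetric:
  assumes v: "v \<in> tangent_space \<A> p" and w: "w \<in> tangent_space \<A> p"
  shows "N v (ext p w) = N w (ext p v)"
proof (rule tangent_eqI[OF _ _ chart_at])
  let ?a = "chart_at \<A> p"
  show Nv: "N v (ext p w) \<in> tangent_space \<A> p" and Nw: "N w (ext p v) \<in> tangent_space \<A> p"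
    by (rule N_tangent[OF nbhd(1,3) nbhd(2)], fact)+
  have const: "deriv_along \<A> u (\<lambda>q. deriv_along \<A> (ext p z q) (\<lambda>x. snd ?a x $ i)) = 0"
    if u: "u \<in> tangent_space \<A> p" for u z i
  proof -
    have "deriv_along \<A> u (\<lambda>q. deriv_along \<A> (ext p z q) (\<lambda>x. snd ?a x $ i)) = deriv_along \<A> u (\<lambda>q. snd z ?a $ i)"
    proof (rule deriv_along_cong[OF nbhd(1)])
      show "fst u \<in> nbhd p" using tangent_base[OF u] nbhd(2) by simp
      show "deriv_along \<A> (ext p z q) (\<lambda>x. snd ?a x $ i) = snd z ?a $ i" if "q \<in> nbhd p" for q
        using deriv_along_chart_component[OF chart_at(1) that ext_tangent[OF that]]
          snd_const_field[OF chart_at(1) that] by simp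
    qed
    also have "\<dots> = 0" by (simp add: deriv_along_def Let_def o_def)
    finally show ?thesis .
  qed
  have "snd (N v (ext p w)) ?a $ i = snd (N w (ext p v)) ?a $ i" for i
    using torsion_free[OF nbhd(1) nbhd(3) nbhd(3) smooth_chart_component[OF chart_at(1)] nbhd(2), of p v w i]
    unfolding ext_at[OF v] ext_at[OF w] const[OF v] const[OF w]
      deriv_along_chart_component[OF chart_at Nv] deriv_along_chart_component[OF chart_at Nw] by simp
  then show "snd (N v (ext p w)) ?a = snd (N w (ext p v)) ?a" by (simp add: vec_eq_iff)
qed

text \<open>The covariant derivative of \<open>\<sigma>(\<phi>)\<close>, by the Leibniz rule applied to the explicit formula.\<close>

definition dsq :: "'m \<Rightarrow> 'm tangent \<Rightarrow> 'm tangent \<Rightarrow> 'm tangent \<Rightarrow> real" where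
  "dsq p u v w = - Im (hp S (clm S v (clp S w (Np u \<phi>))) (\<phi> p) + hp S (clm S v (clp S w (\<phi> p))) (Np u \<phi>)) / 4"

text \<open>The Leibniz rules for Clifford multiplication and for the Hermitian metric differentiate the explicit formula
  for \<open>\<sigma>(\<phi>)\<close> on a pair of vector fields.\<close>

lemma deriv_sq:
  assumes u: "u \<in> tangent_space \<A> p" and v: "v \<in> tangent_space \<A> p" and w: "w \<in> tangent_space \<A> p"
  shows "deriv_along \<A> u (\<lambda>q. sq (\<phi> q) (ext p v q) (ext p w q)) =
    dsq p u v w + sq (\<phi> p) (N u (ext p v)) w + sq (\<phi> p) v (N u (ext p w))"
proof -
  define s where "s = (\<lambda>q. clp S (ext p w q) (\<phi> q))"
  define t where "t = (\<lambda>q. clm S (ext p v q) (s q))"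
  have s: "smooth_section \<A> (Wm S) (nbhd p) s"
    unfolding s_def by (rule clp_smooth[OF nbhd(1,3) \<phi>_section])
  have t: "smooth_section \<A> (Wp S) (nbhd p) t"
    unfolding t_def by (rule clm_smooth[OF nbhd(1,3) s])
  have h: "smooth_map \<A> (nbhd p) (\<lambda>q. hp S (t q) (\<phi> q))"
    by (rule hp_smooth[OF nbhd(1) t \<phi>_section])
  have "fst u \<in> nbhd p" using tangent_base[OF u] nbhd(2) by simp
  moreover have "bounded_linear (\<lambda>z. - Im z / 4)"
    by (rule bounded_linear_compose[OF bounded_linear_divide bounded_linear_minus[OF bounded_linear_Im]])
  ultimately have "deriv_along \<A> u (\<lambda>q. - Im (hp S (t q) (\<phi> q)) / 4) = - Im (deriv_along \<A> u (\<lambda>q. hp S (t q) (\<phi> q))) / 4"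
    by (rule deriv_along_linear[OF h nbhd(1)])
  moreover have "(\<lambda>q. sq (\<phi> q) (ext p v q) (ext p w q)) = (\<lambda>q. - Im (hp S (t q) (\<phi> q)) / 4)"
    by (simp add: sq_def t_def s_def)
  moreover have "deriv_along \<A> u (\<lambda>q. hp S (t q) (\<phi> q)) = hp S (Np u t) (\<phi> p) + hp S (t p) (Np u \<phi>)"
    by (rule hp_deriv[OF nbhd(1) t \<phi>_section nbhd(2) u])
  moreover have tp: "t p = clm S v (clp S w (\<phi> p))" by (simp add: t_def s_def ext_at v w)
  moreover have "Np u t = badd (Wp S) (clm S (N u (ext p v)) (clp S w (\<phi> p)))
      (badd (Wp S) (clm S v (clp S (N u (ext p w)) (\<phi> p))) (clm S v (clp S w (Np u \<phi>))))"
  proof -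
    have "Nm u s = badd (Wm S) (clp S (N u (ext p w)) (\<phi> p)) (clp S w (Np u \<phi>))"
      unfolding s_def Nm_leibniz[OF nbhd(1,3) \<phi>_section nbhd(2) u] ext_at[OF w] ..
    moreover have "Np u t = badd (Wp S) (clm S (N u (ext p v)) (s p)) (clm S v (Nm u s))"
      unfolding t_def Np_leibniz[OF nbhd(1,3) s nbhd(2) u] ext_at[OF v] ..
    moreover have "s p = clp S w (\<phi> p)" by (simp add: s_def ext_at w)
    ultimately show ?thesis
      using clm_add[OF v clp_fibre[OF N_tangent[OF nbhd(1,3,2) u] \<phi>_fibre] clp_fibre[OF w Np_fibre[OF nbhd(1) \<phi>_section nbhd(2) u]]]
      by simp
  qed
  moreover have "clm S (N u (ext p v)) (clp S w (\<phi> p)) \<in> fibre (Wp S) p" "clm S v (clp S (N u (ext p w)) (\<phi> p)) \<in> fibre (Wp S) p"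
    "clm S v (clp S w (Np u \<phi>)) \<in> fibre (Wp S) p"
    by (intro clm_fibre clp_fibre v w u N_tangent[OF nbhd(1,3,2)] \<phi>_fibre Np_fibre[OF nbhd(1) \<phi>_section nbhd(2)])+
  ultimately show ?thesis
    by (simp add: dsq_def sq_def hp_add[where x = p] Wp.add_fibre \<phi>_fibre add_divide_distrib diff_divide_distrib)
qed

abbreviation \<sigma> :: "'m dform" where "\<sigma> \<equiv> \<lambda>y. squaring \<A> g S (\<phi> y)"

text \<open>The terms that contain derivatives of the vector fields cancel in pairs, by the symmetry of the connection and by
  the antisymmetry of \<open>\<sigma>(\<phi>)\<close>.\<close>

lemma ext_deriv_sq:
  assumes u: "u \<in> tangent_space \<A> p" and v: "v \<in> tangent_space \<A> p" and w: "w \<in> tangent_space \<A> p"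
  shows "ext_deriv \<A> 2 \<sigma> p [u, v, w] = dsq p u v w - dsq p v u w + dsq p w u v"
proof -
  have d: "deriv_along \<A> x (\<lambda>q. \<sigma> q [ext p y q, ext p z q]) =
      dsq p x y z + sq (\<phi> p) (N x (ext p y)) z + sq (\<phi> p) y (N x (ext p z))"
    if x: "x \<in> tangent_space \<A> p" and y: "y \<in> tangent_space \<A> p" and z: "z \<in> tangent_space \<A> p" for x y z
  proof -
    have "\<sigma> q [ext p y q, ext p z q] = sq (\<phi> q) (ext p y q) (ext p z q)" if "q \<in> nbhd p" for q
    proof -
      have "[ext p y q, ext p z q] \<in> vectors_at \<A> 2 q"
        using ext_tangent[OF that] by (simp add: vectors_at_def)
      then show ?thesis by (simp add: squaring_eq[OF \<phi>_fibre])
    qed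
    moreover have "fst x \<in> nbhd p" using tangent_base[OF x] nbhd(2) by simp
    ultimately have "deriv_along \<A> x (\<lambda>q. \<sigma> q [ext p y q, ext p z q]) = deriv_along \<A> x (\<lambda>q. sq (\<phi> q) (ext p y q) (ext p z q))"
      by (intro deriv_along_cong[OF nbhd(1)])
    then show ?thesis by (simp add: deriv_sq[OF x y z])
  qed
  have "[u, v, w] \<in> vectors_at \<A> (Suc 2) p" using u v w by (simp add: vectors_at_def)
  then have "ext_deriv \<A> 2 \<sigma> p [u, v, w] = deriv_along \<A> u (\<lambda>q. \<sigma> q [ext p v q, ext p w q])
      - deriv_along \<A> v (\<lambda>q. \<sigma> q [ext p u q, ext p w q]) + deriv_along \<A> w (\<lambda>q. \<sigma> q [ext p u q, ext p v q])"
    by (simp add: ext_deriv_def numeral_2_eq_2)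
  moreover have "sq (\<phi> p) v (N u (ext p w)) = - sq (\<phi> p) (N u (ext p w)) v"
    "sq (\<phi> p) u (N v (ext p w)) = - sq (\<phi> p) (N v (ext p w)) u"
    "sq (\<phi> p) u (N w (ext p v)) = - sq (\<phi> p) (N w (ext p v)) u"
    by (rule sq_anti[OF \<phi>_fibre]; intro u v w N_tangent[OF nbhd(1,3,2)])+
  ultimately show ?thesis
    unfolding d[OF u v w] d[OF v u w] d[OF w u v]
    by (simp add: N_symmetric[OF v u] N_symmetric[OF w u] N_symmetric[OF w v])
qed

lemma \<sigma>_self_dual: "\<sigma> x \<in> self_dual_at \<A> g x"
  unfolding squaring_eq[OF \<phi>_fibre] by (rule sq_self_dual[OF \<phi>_fibre])

text \<open>As \<open>\<sigma>(\<phi>)\<close> is self-dual, \<open>d\<^sup>*\<sigma>(\<phi>) = - *d\<sigma>(\<phi>)\<close>.\<close>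

lemma codiff_\<sigma>:
  fixes x :: 'm
  defines "e \<equiv> frame_at \<A> g x"
  defines "b \<equiv> \<lambda>i j k. dsq x (e i) (e j) (e k) - dsq x (e j) (e i) (e k) + dsq x (e k) (e i) (e j)"
  assumes anti: "\<And>k i j. dsq x (e k) (e i) (e j) = - dsq x (e k) (e j) (e i)"
  shows "codiff \<A> g 2 \<sigma> x [e 1] = b 2 3 4" "codiff \<A> g 2 \<sigma> x [e 2] = - b 1 3 4"
    "codiff \<A> g 2 \<sigma> x [e 3] = b 1 2 4" "codiff \<A> g 2 \<sigma> x [e 4] = - b 1 2 3"
proof -
  have "hodge \<A> g 2 \<sigma> = \<sigma>"
    using \<sigma>_self_dual by (auto simp: hodge_def self_dual_at_def)
  then have c: "codiff \<A> g 2 \<sigma> x [e l] = - hodge_at \<A> g 3 x (ext_deriv \<A> 2 \<sigma> x) [e l]" for l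
    by (simp add: codiff_def hodge_def)
  have d: "ext_deriv \<A> 2 \<sigma> x [e i, e j, e k] = b i j k" for i j k
    unfolding b_def e_def by (rule ext_deriv_sq) (rule frame_tangent)+
  have "b j i k = - b i j k" "b i k j = - b i j k" for i j k
    using anti[of k j i] anti[of i k j] anti[of j i k] anti[of k i j] by (simp_all add: b_def)
  note h = hodge_3[of "ext_deriv \<A> 2 \<sigma> x" x, folded e_def, unfolded d, OF this]
  show "codiff \<A> g 2 \<sigma> x [e 1] = b 2 3 4" "codiff \<A> g 2 \<sigma> x [e 2] = - b 1 3 4"
    "codiff \<A> g 2 \<sigma> x [e 3] = b 1 2 4" "codiff \<A> g 2 \<sigma> x [e 4] = - b 1 2 3"
    by (simp_all add: c h)
qed

text \<open>Both sides lie in one fibre of negative spinors; in coordinates they are the two sides of the pointwise identity.\<close>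

lemma dirac_identity:
  "bscl (Wm S) (hp S (\<phi> x) (\<phi> x)) (dirac \<A> g S Np \<phi> x) =
    bscl (Wm S) \<i> (cl1 \<A> g S (\<lambda>vs. 2 * codiff \<A> g 2 \<sigma> x vs + real_pairing \<A> S Np \<phi> x vs) (\<phi> x))"
proof -
  define e where "e = frame_at \<A> g x"
  define a where "a = triv_at (Wp S) x (\<phi> x)"
  define \<psi> where "\<psi> k = triv_at (Wp S) x (Np (e k) \<phi>)" for k
  let ?\<alpha> = "\<lambda>vs. 2 * codiff \<A> g 2 \<sigma> x vs + real_pairing \<A> S Np \<phi> x vs"
  have e: "e i \<in> tangent_space \<A> x" for i unfolding e_def by (rule frame_tangent)
  have base: "bproj (Wp S) (\<phi> x) = x" using \<phi>_fibre[of x] by (simp add: fibre_def)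
  have N: "Np (e k) \<phi> \<in> fibre (Wp S) x" for k
    using Np_fibre[OF open_UNIV \<phi>_smooth UNIV_I e] .
  have hc: "hc x a (\<psi> k) = hp S (\<phi> x) (Np (e k) \<phi>)" "hc x (\<psi> k) a = hp S (Np (e k) \<phi>) (\<phi> x)" for k
    by (simp_all add: a_def \<psi>_def hp_hc[OF \<phi>_fibre N] hp_hc[OF N \<phi>_fibre])
  have tau: "dsq x (e k) (e i) (e j) = pt.tau x a (\<psi> k) i j" for i j k
    unfolding dsq_def hp_hc[OF clm_fibre[OF e clp_fibre[OF e N]] \<phi>_fibre] hp_hc[OF clm_fibre[OF e clp_fibre[OF e \<phi>_fibre]] N]
      triv_clm[OF e clp_fibre[OF e N]] triv_clm[OF e clp_fibre[OF e \<phi>_fibre]] triv_clp[OF e N] triv_clp[OF e \<phi>_fibre]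
    unfolding pt.tau_def a_def \<psi>_def e_def ..
  have pairing: "real_pairing \<A> S Np \<phi> x [e k] = Im (hc x (\<psi> k) a)" for k
  proof -
    have "hp S (Np (e k) \<phi>) (bscl (Wp S) \<i> (\<phi> x)) = cnj (hp S (bscl (Wp S) \<i> (\<phi> x)) (Np (e k) \<phi>))"
      by (rule hp_herm[OF N Wp.scale_fibre[OF \<phi>_fibre]])
    also have "\<dots> = - \<i> * cnj (hp S (\<phi> x) (Np (e k) \<phi>))" by (simp add: hp_scale[OF \<phi>_fibre N])
    also have "\<dots> = - \<i> * hp S (Np (e k) \<phi>) (\<phi> x)" by (simp add: hp_herm[OF N \<phi>_fibre])
    finally show ?thesis using e[of k] by (simp add: real_pairing_def vectors_at_1 hc del: One_nat_def)
  qed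
  have \<alpha>: "?\<alpha> [e k] = 2 * codiff \<A> g 2 \<sigma> x [e k] + Im (hc x (\<psi> k) a)" for k by (simp add: pairing)
  have "pt.tau x a (\<psi> k) i j = - pt.tau x a (\<psi> k) j i" for k i j by (rule pt.tau_anti)
  note cod = codiff_\<sigma>[of x, folded e_def, unfolded tau, OF this]
  have D: "dirac \<A> g S Np \<phi> x = fibre_sum (Wm S) x (\<lambda>k. clp S (e k) (Np (e k) \<phi>)) [1, 2, 3, 4]"
    by (simp add: dirac_def Let_def e_def)
  have C: "cl1 \<A> g S ?\<alpha> (\<phi> x) = fibre_sum (Wm S) x (\<lambda>i. bscl (Wm S) (of_real (?\<alpha> [e i])) (clp S (e i) (\<phi> x))) [1, 2, 3, 4]"
    by (simp add: cl1_def base Let_def e_def)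
  have Df: "clp S (e k) (Np (e k) \<phi>) \<in> fibre (Wm S) x" for k by (rule clp_fibre[OF e N])
  have Cf: "bscl (Wm S) r (clp S (e k) (\<phi> x)) \<in> fibre (Wm S) x" for k r
    by (rule Wm.scale_fibre[OF clp_fibre[OF e \<phi>_fibre]])
  have norm: "hp S (\<phi> x) (\<phi> x) = hc x a a" by (simp add: a_def hp_hc[OF \<phi>_fibre \<phi>_fibre])
  have mem: "dirac \<A> g S Np \<phi> x \<in> fibre (Wm S) x" "cl1 \<A> g S ?\<alpha> (\<phi> x) \<in> fibre (Wm S) x"
    unfolding D C by (rule Wm.fibre_sum_fibre, rule Df Cf)+
  have tD: "triv_at (Wm S) x (dirac \<A> g S Np \<phi> x) = cp x (e 1) (\<psi> 1) + cp x (e 2) (\<psi> 2) + cp x (e 3) (\<psi> 3) + cp x (e 4) (\<psi> 4)"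
    unfolding D by (subst Wm.triv_fibre_sum, rule Df) (simp add: triv_clp[OF e N] \<psi>_def add.assoc)
  have tC: "triv_at (Wm S) x (cl1 \<A> g S ?\<alpha> (\<phi> x)) =
      of_real (2 * codiff \<A> g 2 \<sigma> x [e 1] + Im (hc x (\<psi> 1) a)) *s cp x (e 1) a +
      of_real (2 * codiff \<A> g 2 \<sigma> x [e 2] + Im (hc x (\<psi> 2) a)) *s cp x (e 2) a +
      of_real (2 * codiff \<A> g 2 \<sigma> x [e 3] + Im (hc x (\<psi> 3) a)) *s cp x (e 3) a +
      of_real (2 * codiff \<A> g 2 \<sigma> x [e 4] + Im (hc x (\<psi> 4) a)) *s cp x (e 4) a"
    unfolding C by (subst Wm.triv_fibre_sum, rule Cf)
      (simp add: Wm.triv_scale[OF clp_fibre[OF e \<phi>_fibre]] triv_clp[OF e \<phi>_fibre] pairing add.assoc flip: a_def)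
  have "triv_at (Wm S) x (bscl (Wm S) (hp S (\<phi> x) (\<phi> x)) (dirac \<A> g S Np \<phi> x)) =
      triv_at (Wm S) x (bscl (Wm S) \<i> (cl1 \<A> g S ?\<alpha> (\<phi> x)))"
    unfolding Wm.triv_scale[OF mem(1)] Wm.triv_scale[OF mem(2)] tD tC cod norm
    using pt.pointwise_identity[of x a \<psi>]
    unfolding e_def mult_minus_left mult_minus_right .
  then show ?thesis
    by (rule Wm.fibre_eqI[OF Wm.scale_fibre[OF mem(1)] Wm.scale_fibre[OF mem(2)]])
qed

end

theorem theorem3p15:
  fixes \<A> :: "'m::{t2_space, second_countable_topology} chart set"
    and g :: "'m tangent \<Rightarrow> 'm tangent \<Rightarrow> real"
    and S :: "('m, 'p, 'q, 'l) spinc"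
    and N :: "'m tangent \<Rightarrow> ('m \<Rightarrow> 'm tangent) \<Rightarrow> 'm tangent"
    and A :: "'m tangent \<Rightarrow> ('m \<Rightarrow> 'l) \<Rightarrow> 'l"
    and Np :: "'m tangent \<Rightarrow> ('m \<Rightarrow> 'p) \<Rightarrow> 'p"
    and Nm :: "'m tangent \<Rightarrow> ('m \<Rightarrow> 'q) \<Rightarrow> 'q"
    and \<phi> :: "'m \<Rightarrow> 'p"
  assumes "closed_oriented_4manifold \<A>"
    and "riemannian_metric \<A> g"
    and "levi_civita \<A> g N"
    and "spinc_structure \<A> g S"
    and "metric_connection \<A> (detL S) (hL S) A"
    and "spinc_connection \<A> g S N A Np Nm"
    and "smooth_section \<A> (Wp S) UNIV \<phi>"
  shows "\<forall>x. bscl (Wm S) (hp S (\<phi> x) (\<phi> x)) (dirac \<A> g S Np \<phi> x) =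
    bscl (Wm S) \<i>
      (cl1 \<A> g S
         (\<lambda>vs. 2 * codiff \<A> g 2 (\<lambda>y. squaring \<A> g S (\<phi> y)) x vs + real_pairing \<A> S Np \<phi> x vs)
         (\<phi> x))"
proof -
  interpret spinor_field \<A> g S N A Np Nm \<phi>
    using assms by unfold_locales (simp_all add: closed_oriented_4manifold_def)
  show ?thesis using dirac_identity by blast
qed

end
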